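(* The problem of recognizing squco graphs (given a finite simple graph $G$, decide whether $G^2 \cong \overline{G}$) is graph isomorphism complete, i.e., it is polynomial-time equivalent to the Graph Isomorphism problem (deciding whether two given finite simple graphs are isomorphic).
   Context: All graphs are finite and simple. The square $G^2$ of a graph $G$ has vertex set $V(G)$, and two distinct vertices are adjacent in $G^2$ if and only if their distance in $G$ is at most $2$. A graph $G$ is square-complementary (squco) if $G^2$ is isomorphic to the complement $\overline{G}$ of $G$. *)

theory Defs
  imports
    "Graph_Theory.Pair_Digraph"
    "Graph_Theory.Digraph_Isomorphism"
    "Graph_Theory.Shortest_Path"
    "HOL-Computational_Algebra.Polynomial"
begin

section \<open>Square-complementary graphs\<close>

text \<open>
  A finite simple graph is a \<^locale>\<open>pair_graph\<close>: finite, loopfree, and with a symmetric arc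
  relation, the edge \<open>{u, v}\<close> being the two arcs \<open>(u, v)\<close> and \<open>(v, u)\<close>.  The operations and
  predicates below are only meant to be applied to such graphs.
\<close>

definition graph_dist :: "'a pair_pre_digraph \<Rightarrow> 'a \<Rightarrow> 'a \<Rightarrow> ereal" where
  "graph_dist G u v = wf_digraph.\<mu> (with_proj G) (\<lambda>_. 1) u v"

definition graph_square :: "'a pair_pre_digraph \<Rightarrow> 'a pair_pre_digraph" where
  "graph_square G =
    \<lparr> pverts = pverts G,
      parcs = {(u, v). u \<in> pverts G \<and> v \<in> pverts G \<and> u \<noteq> v \<and> graph_dist G u v \<le> 2} \<rparr>"

definition graph_complement :: "'a pair_pre_digraph \<Rightarrow> 'a pair_pre_digraph" where
  "graph_complement G =
    \<lparr> pverts = pverts G,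
      parcs = {(u, v). u \<in> pverts G \<and> v \<in> pverts G \<and> u \<noteq> v \<and> (u, v) \<notin> parcs G} \<rparr>"

definition graph_iso :: "'a pair_pre_digraph \<Rightarrow> 'b pair_pre_digraph \<Rightarrow> bool" where
  "graph_iso G H \<longleftrightarrow> digraph_iso (with_proj G) (with_proj H)"

definition squco :: "'a pair_pre_digraph \<Rightarrow> bool" where
  "squco G \<longleftrightarrow> graph_iso (graph_square G) (graph_complement G)"


section \<open>Polynomial-time computation\<close>

text \<open>
  The machine model is that of structured programs over finitely many registers, each holding a stack of
  bits.  One step pushes or pops a bit, clears or copies a register, or
  evaluates a test.  A step increases the length of the longest register by at most one, so after
  \<open>t\<close> steps on an input of length \<open>n\<close> all registers have length at most \<open>n + t\<close>, and each step can be
  carried out by a multitape Turing machine in time \<open>O(n + t)\<close>.  Conversely a Turing machine tape is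
  a pair of stacks, so that a Turing machine is simulated with constant overhead per step.  Hence
  polynomial time in this model is polynomial time on Turing machines.
\<close>

datatype test =
    Nonempty nat
  | Top nat  \<comment> \<open>nonempty, and the top bit is \<^const>\<open>True\<close>\<close>

datatype prog =
    Skip
  | Clear nat
  | Copy nat nat  \<comment> \<open>target, source\<close>
  | Push nat bool
  | Pop nat
  | Seq prog prog
  | Cond test prog prog
  | Loop test prog

type_synonym state = "nat \<Rightarrow> bool list"

fun test_holds :: "test \<Rightarrow> state \<Rightarrow> bool" where
  "test_holds (Nonempty x) s \<longleftrightarrow> s x \<noteq> []"
| "test_holds (Top x) s \<longleftrightarrow> s x \<noteq> [] \<and> hd (s x)"

text \<open>\<open>exec c s t s'\<close>: started in \<open>s\<close>, the program \<open>c\<close> halts in \<open>s'\<close> after exactly \<open>t\<close> steps.\<close>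

inductive exec :: "prog \<Rightarrow> state \<Rightarrow> nat \<Rightarrow> state \<Rightarrow> bool" where
  Skip: "exec Skip s 1 s"
| Clear: "exec (Clear x) s 1 (s(x := []))"
| Copy: "exec (Copy x y) s 1 (s(x := s y))"
| Push: "exec (Push x b) s 1 (s(x := b # s x))"
| Pop: "exec (Pop x) s 1 (s(x := tl (s x)))"
| Seq: "exec c s t s' \<Longrightarrow> exec d s' u s'' \<Longrightarrow> exec (Seq c d) s (t + u) s''"
| Cond_True: "test_holds b s \<Longrightarrow> exec c s t s' \<Longrightarrow> exec (Cond b c d) s (Suc t) s'"
| Cond_False: "\<not> test_holds b s \<Longrightarrow> exec d s t s' \<Longrightarrow> exec (Cond b c d) s (Suc t) s'"
| Loop_False: "\<not> test_holds b s \<Longrightarrow> exec (Loop b c) s 1 s"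
| Loop_True: "test_holds b s \<Longrightarrow> exec c s t s' \<Longrightarrow> exec (Loop b c) s' u s''
    \<Longrightarrow> exec (Loop b c) s (Suc (t + u)) s''"

text \<open>Input and output are in register 0; the other registers start empty.\<close>

definition init_state :: "bool list \<Rightarrow> state" where
  "init_state w = (\<lambda>_. [])(0 := w)"

definition poly_time_computable :: "(bool list \<Rightarrow> bool list) \<Rightarrow> bool" where
  "poly_time_computable f \<longleftrightarrow>
    (\<exists>(c :: prog) (p :: nat poly). \<forall>w. \<exists>t s.
      exec c (init_state w) t s \<and> s 0 = f w \<and> t \<le> poly p (length w))"

definition poly_reducible :: "bool list set \<Rightarrow> bool list set \<Rightarrow> bool" (infix \<open>\<le>\<^sub>p\<close> 50) where
  "A \<le>\<^sub>p B \<longleftrightarrow> (\<exists>f. poly_time_computable f \<and> (\<forall>w. w \<in> A \<longleftrightarrow> f w \<in> B))"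

definition poly_equivalent :: "bool list set \<Rightarrow> bool list set \<Rightarrow> bool" (infix \<open>\<equiv>\<^sub>p\<close> 50) where
  "A \<equiv>\<^sub>p B \<longleftrightarrow> A \<le>\<^sub>p B \<and> B \<le>\<^sub>p A"


section \<open>The decision problems\<close>

text \<open>
  As inputs, graphs with \<open>n\<close> vertices have vertex set \<open>{0, \<dots>, n - 1}\<close>, and the encoding is \<open>n\<close> in unary,
  terminated by \<^const>\<open>False\<close>, followed by the adjacency matrix row by row.  The unary prefix makes the
  encoding self-delimiting, so that a pair of graphs can be encoded by concatenation.
\<close>

definition input_graph :: "nat pair_pre_digraph \<Rightarrow> bool" where
  "input_graph G \<longleftrightarrow> pair_graph G \<and> (\<exists>n. pverts G = {..<n})"

definition encode_graph :: "nat pair_pre_digraph \<Rightarrow> bool list" where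
  "encode_graph G = (let n = card (pverts G) in
    replicate n True @ [False] @ concat (map (\<lambda>i. map (\<lambda>j. (i, j) \<in> parcs G) [0..<n]) [0..<n]))"

definition SQUCO_RECOGNITION :: "bool list set" where
  "SQUCO_RECOGNITION = {encode_graph G |G. input_graph G \<and> squco G}"

definition GRAPH_ISOMORPHISM :: "bool list set" where
  "GRAPH_ISOMORPHISM =
    {encode_graph G @ encode_graph H |G H. input_graph G \<and> input_graph H \<and> graph_iso G H}"

definition graph_isomorphism_complete :: "bool list set \<Rightarrow> bool" where
  "graph_isomorphism_complete A \<longleftrightarrow> A \<equiv>\<^sub>p GRAPH_ISOMORPHISM"

end

theory Submission
  imports Defs
begin

text \<open>
  Recognition reduces to isomorphism by computing the square and the complement.

  For the converse, let \<open>K\<close> be a bipartite graph in which any two vertices of the same side have a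
  common neighbour. The complement of \<open>K\<^sup>2\<close> is then the bipartite complement of \<open>K\<close>, so \<open>K\<close> is squco
  iff it is isomorphic to its bipartite complement. Given \<open>G\<close> and \<open>H\<close> on \<open>n \<ge> 3\<close> vertices, let
  \<open>P\<^sub>G\<close> be the bipartite graph between \<open>V\<close> and \<open>V \<times> V\<close> in which \<open>(j, k)\<close> is adjacent to \<open>j\<close>, and also
  to \<open>k\<close> if \<open>jk\<close> is an edge of \<open>G\<close>. The sides of \<open>K\<close> are \<open>X\<^sub>1 \<union> X\<^sub>2 \<union> X\<^sub>0\<close> and \<open>Y\<^sub>1 \<union> Y\<^sub>2 \<union> Y\<^sub>0\<close>,
  where \<open>X\<^sub>1, Y\<^sub>1\<close> carry \<open>P\<^sub>G\<close>, \<open>X\<^sub>2, Y\<^sub>2\<close> carry the bipartite complement of \<open>P\<^sub>H\<close>, \<open>X\<^sub>0, Y\<^sub>0\<close> carry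
  \<open>2K\<^sub>2\<close>, the pairs \<open>X\<^sub>1 Y\<^sub>2\<close>, \<open>X\<^sub>0 Y\<^sub>1\<close>, \<open>X\<^sub>2 Y\<^sub>0\<close> are complete and the remaining pairs empty. Bipartite
  complementation exchanges the roles of \<open>G\<close> and \<open>H\<close>. Conversely \<open>X\<^sub>1\<close> is the set of vertices of
  degree at least \<open>n\<^sup>2 + 2\<close>, and \<open>i, j\<close> are adjacent in \<open>G\<close> iff some vertex has exactly these two
  neighbours in \<open>X\<^sub>1\<close>; so an isomorphism between \<open>K\<close> and its bipartite complement makes \<open>G\<close> and \<open>H\<close>
  isomorphic. For \<open>n \<le> 2\<close>, isomorphic graphs are equal.

  Both reductions output the truth values of formulas with bounded quantifiers over the input word,
  and such formulas are compiled to nested counting loops.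
\<close>


section \<open>Graphs as matrices\<close>

text \<open>On pair digraphs tails and heads are given by \<open>fst\<close> and \<open>snd\<close>
  on both sides, which forces the arc map of a digraph isomorphism to apply the vertex map to both
  ends. A vertex bijection that respects adjacency therefore carries all the information.\<close>

lemma graph_iso_iff:
  assumes "pair_wf_digraph G" "pair_wf_digraph H"
  shows "graph_iso G H \<longleftrightarrow> (\<exists>f. bij_betw f (pverts G) (pverts H) \<and>
    (\<forall>u \<in> pverts G. \<forall>v \<in> pverts G. (u, v) \<in> parcs G \<longleftrightarrow> (f u, f v) \<in> parcs H))"
    (is "?L \<longleftrightarrow> ?R")
proof
  interpret G: pair_wf_digraph G by fact
  interpret H: pair_wf_digraph H by fact
  {
    assume ?L
    then obtain h where h: "pre_digraph.digraph_isomorphism (with_proj G) h"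
      and H: "with_proj H = app_iso h (with_proj G)"
      unfolding graph_iso_def digraph_iso_def by blast
    have V: "pverts H = iso_verts h ` pverts G" and E: "parcs H = iso_arcs h ` parcs G"
      and T: "fst = iso_tail h" and D: "snd = iso_head h"
      using arg_cong[OF H, of verts] arg_cong[OF H, of arcs] arg_cong[OF H, of tail]
        arg_cong[OF H, of head] by auto
    have inj: "inj_on (iso_verts h) (pverts G)"
      and fst_arc: "\<And>a. a \<in> parcs G \<Longrightarrow> fst (iso_arcs h a) = iso_verts h (fst a)"
      and snd_arc: "\<And>a. a \<in> parcs G \<Longrightarrow> snd (iso_arcs h a) = iso_verts h (snd a)"
      using h unfolding pre_digraph.digraph_isomorphism_def by (auto simp: T D)
    have arc: "iso_arcs h (u, v) = (iso_verts h u, iso_verts h v)" if "(u, v) \<in> parcs G" for u v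
      using fst_arc[OF that] snd_arc[OF that] by (simp add: prod_eq_iff)
    have "(u, v) \<in> parcs G \<longleftrightarrow> (iso_verts h u, iso_verts h v) \<in> parcs H"
      if uv: "u \<in> pverts G" "v \<in> pverts G" for u v
    proof
      assume "(iso_verts h u, iso_verts h v) \<in> parcs H"
      then obtain a b where ab: "(a, b) \<in> parcs G"
        and "(iso_verts h u, iso_verts h v) = iso_arcs h (a, b)"
        unfolding E by auto
      then have "iso_verts h u = iso_verts h a" "iso_verts h v = iso_verts h b"
        by (auto simp: arc)
      with inj uv G.in_arcsD1[OF ab] G.in_arcsD2[OF ab] ab show "(u, v) \<in> parcs G"
        by (auto dest: inj_onD)
    next
      assume "(u, v) \<in> parcs G"
      then have "iso_arcs h (u, v) \<in> parcs H" unfolding E by (rule imageI)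
      with \<open>(u, v) \<in> parcs G\<close> show "(iso_verts h u, iso_verts h v) \<in> parcs H"
        by (simp only: arc)
    qed
    with inj V show ?R
      by (intro exI[of _ "iso_verts h"]) (auto simp: bij_betw_def)
  }
  {
    assume ?R
    then obtain f where f: "bij_betw f (pverts G) (pverts H)"
      and arcs: "\<And>u v. u \<in> pverts G \<Longrightarrow> v \<in> pverts G \<Longrightarrow>
        (u, v) \<in> parcs G \<longleftrightarrow> (f u, f v) \<in> parcs H"
      by blast
    define h :: "('a, 'a \<times> 'a, 'b, 'b \<times> 'b) digraph_isomorphism"
      where "h = \<lparr>iso_verts = f, iso_arcs = map_prod f f, iso_head = snd, iso_tail = fst\<rparr>"
    have inj: "inj_on f (pverts G)" and V: "f ` pverts G = pverts H"
      using f by (auto simp: bij_betw_def)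
    have "inj_on (map_prod f f) (parcs G)"
      by (rule inj_on_subset[OF map_prod_inj_on[OF inj inj]])
        (rule subsetI, simp only: mem_Times_iff G.arc_fst_in_verts G.arc_snd_in_verts simp_thms)
    then have "pre_digraph.digraph_isomorphism (with_proj G) h"
      using inj G.wf_digraph_axioms
      unfolding pre_digraph.digraph_isomorphism_def h_def by simp
    moreover have "map_prod f f ` parcs G = parcs H"
    proof
      show "map_prod f f ` parcs G \<subseteq> parcs H"
      proof (rule subsetI, elim imageE)
        fix e a assume e: "e = map_prod f f a" and a: "a \<in> parcs G"
        have "(fst a, snd a) \<in> parcs G" using a by simp
        then have "(f (fst a), f (snd a)) \<in> parcs H"
          using arcs[OF G.arc_fst_in_verts[OF a] G.arc_snd_in_verts[OF a]] by blast
        then show "e \<in> parcs H" by (simp add: e map_prod_def split_beta)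
      qed
      show "parcs H \<subseteq> map_prod f f ` parcs G"
      proof
        fix e assume e: "e \<in> parcs H"
        obtain a b where ab: "e = (a, b)" by (cases e)
        with e V obtain u v where "u \<in> pverts G" "v \<in> pverts G" "a = f u" "b = f v"
          by (metis H.in_arcsD1 H.in_arcsD2 imageE)
        with e ab arcs show "e \<in> map_prod f f ` parcs G"
          by (intro image_eqI[of _ _ "(u, v)"]) auto
      qed
    qed
    ultimately show ?L
      unfolding graph_iso_def digraph_iso_def
      by (intro exI[of _ h]) (simp add: app_iso_def h_def V with_proj_def)
  }
qed

section \<open>Graphs on an initial segment as adjacency matrices\<close>

definition nat_graph :: "nat \<Rightarrow> (nat \<Rightarrow> nat \<Rightarrow> bool) \<Rightarrow> nat pair_pre_digraph" where
  "nat_graph n A = \<lparr>pverts = {..<n}, parcs = {(u, v). u < n \<and> v < n \<and> A u v}\<rparr>"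

definition simple_matrix :: "nat \<Rightarrow> (nat \<Rightarrow> nat \<Rightarrow> bool) \<Rightarrow> bool" where
  "simple_matrix n A \<longleftrightarrow> (\<forall>u<n. \<forall>v<n. A u v \<longrightarrow> A v u \<and> u \<noteq> v)"

definition matrix_iso :: "nat \<Rightarrow> (nat \<Rightarrow> nat \<Rightarrow> bool) \<Rightarrow> (nat \<Rightarrow> nat \<Rightarrow> bool) \<Rightarrow> bool" where
  "matrix_iso n A B \<longleftrightarrow>
    (\<exists>f. bij_betw f {..<n} {..<n} \<and> (\<forall>u<n. \<forall>v<n. A u v \<longleftrightarrow> B (f u) (f v)))"

definition matrix_square :: "nat \<Rightarrow> (nat \<Rightarrow> nat \<Rightarrow> bool) \<Rightarrow> nat \<Rightarrow> nat \<Rightarrow> bool" where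
  "matrix_square n A u v \<longleftrightarrow> u \<noteq> v \<and> (A u v \<or> (\<exists>w<n. A u w \<and> A w v))"

definition matrix_complement :: "(nat \<Rightarrow> nat \<Rightarrow> bool) \<Rightarrow> nat \<Rightarrow> nat \<Rightarrow> bool" where
  "matrix_complement A u v \<longleftrightarrow> u \<noteq> v \<and> \<not> A u v"

definition encode_matrix :: "nat \<Rightarrow> (nat \<Rightarrow> nat \<Rightarrow> bool) \<Rightarrow> bool list" where
  "encode_matrix n A =
    replicate n True @ [False] @ concat (map (\<lambda>i. map (\<lambda>j. A i j) [0..<n]) [0..<n])"

lemma nat_graph_sel [simp]:
  "pverts (nat_graph n A) = {..<n}"
  "(u, v) \<in> parcs (nat_graph n A) \<longleftrightarrow> u < n \<and> v < n \<and> A u v"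
  by (simp_all add: nat_graph_def)

lemma finite_parcs_nat_graph: "finite (parcs (nat_graph n A))"
  by (rule finite_subset[of _ "{..<n} \<times> {..<n}"]) (auto simp: nat_graph_def)

lemma pair_wf_nat_graph [simp]: "pair_wf_digraph (nat_graph n A)"
  by unfold_locales (auto simp: nat_graph_def)

lemma input_graph_nat_graph: "simple_matrix n A \<Longrightarrow> input_graph (nat_graph n A)"
  unfolding input_graph_def using finite_parcs_nat_graph[of n A]
  by (intro conjI exI[of _ n]; (unfold_locales)?)
    (auto simp: simple_matrix_def symmetric_def nat_graph_def sym_def)

lemma input_graphE:
  assumes "input_graph G"
  obtains n A where "simple_matrix n A" "G = nat_graph n A"
proof -
  obtain n where n: "pverts G = {..<n}" using assms by (auto simp: input_graph_def)
  interpret pair_graph G using assms by (simp add: input_graph_def)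
  show thesis
  proof
    show "simple_matrix n (\<lambda>u v. (u, v) \<in> parcs G)"
      using arcs_symmetric no_loops' by (auto simp: simple_matrix_def)
    show "G = nat_graph n (\<lambda>u v. (u, v) \<in> parcs G)"
      using in_arcsD1 in_arcsD2 n
      by (intro pair_pre_digraph.equality) (auto simp: nat_graph_def)
  qed
qed

lemma graph_iso_nat_graph:
  "graph_iso (nat_graph n A) (nat_graph m B) \<longleftrightarrow> n = m \<and> matrix_iso n A B"
proof -
  have "n = m" if "bij_betw f {..<n} {..<m}" for f
    using bij_betw_same_card[OF that] by simp
  then show ?thesis
    unfolding matrix_iso_def
    by (subst graph_iso_iff) (auto, (metis bij_betw_apply lessThan_iff)+)
qed

lemma matrix_iso_sym:
  assumes "matrix_iso n A B"
  shows "matrix_iso n B A"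
proof -
  obtain f where f: "bij_betw f {..<n} {..<n}" and fA: "\<And>u v. u < n \<Longrightarrow> v < n \<Longrightarrow> A u v \<longleftrightarrow> B (f u) (f v)"
    using assms unfolding matrix_iso_def by blast
  define g where "g = inv_into {..<n} f"
  have g: "bij_betw g {..<n} {..<n}"
    unfolding g_def using f by (rule bij_betw_inv_into)
  have "g u < n" "f (g u) = u" if "u < n" for u
    using that g f bij_betw_apply[OF g] bij_betw_inv_into_right[OF f] by (auto simp: g_def)
  with fA g show ?thesis
    unfolding matrix_iso_def by (intro exI[of _ g]) auto
qed

lemma matrix_iso_trans:
  assumes "matrix_iso n A B" "matrix_iso n B C"
  shows "matrix_iso n A C"
proof -
  obtain f g where f: "bij_betw f {..<n} {..<n}" "\<forall>u<n. \<forall>v<n. A u v \<longleftrightarrow> B (f u) (f v)"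
    and g: "bij_betw g {..<n} {..<n}" "\<forall>u<n. \<forall>v<n. B u v \<longleftrightarrow> C (g u) (g v)"
    using assms unfolding matrix_iso_def by blast
  have "f u < n" if "u < n" for u using that bij_betw_apply[OF f(1)] by auto
  with f g show ?thesis
    unfolding matrix_iso_def by (intro exI[of _ "g \<circ> f"]) (auto intro: bij_betw_trans)
qed

section \<open>Complements and squares of matrix graphs\<close>

lemma graph_complement_nat_graph:
  "graph_complement (nat_graph n A) = nat_graph n (matrix_complement A)"
  by (auto simp: graph_complement_def nat_graph_def matrix_complement_def)

text \<open>With unit weights the cost of a walk is its length, so distance at most 2 means a walk
  of at most two arcs; since \<open>u\<close> and \<open>v\<close> differ, it has one or
  two.\<close>

lemma graph_dist_le_2:
  assumes "pair_wf_digraph G" "u \<in> pverts G" "u \<noteq> v"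
  shows "graph_dist G u v \<le> 2 \<longleftrightarrow>
    (u, v) \<in> parcs G \<or> (\<exists>w. (u, w) \<in> parcs G \<and> (w, v) \<in> parcs G)"
    (is "_ \<longleftrightarrow> ?R")
proof -
  interpret pair_wf_digraph G by fact
  have cost: "awalk_cost (\<lambda>_. 1) p = real (length p)" for p :: "('a \<times> 'a) list"
    by (induction p) auto
  show ?thesis
  proof
    assume le: "graph_dist G u v \<le> 2"
    have "\<exists>p. awalk u p v \<and> length p \<le> 2"
    proof (rule ccontr)
      \<comment> \<open>Lengths are integers, so every walk has length at least 3, and the infimum
        is at least 3 as well; it is infinite if there is no walk.\<close>
      assume "\<not> ?thesis"
      then have "\<And>p. awalk u p v \<Longrightarrow> 3 \<le> length p" by force
      then have "ereal 3 \<le> graph_dist G u v"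
        unfolding graph_dist_def \<mu>_def by (intro INF_greatest) (auto simp: cost)
      from order_trans[OF this le] have "ereal 3 \<le> 2" .
      then show False by simp
    qed
    then obtain p where p: "awalk u p v" "length p \<le> 2" by blast
    then consider "p = []" | a where "p = [a]" | a b where "p = [a, b]"
      by (cases p; cases "tl p"; cases "tl (tl p)") auto
    then show ?R
      using p(1) assms(3) by cases (auto simp: awalk_def)
  next
    assume ?R
    then obtain p where "awalk u p v" "length p \<le> 2"
    proof (elim disjE exE conjE)
      assume "(u, v) \<in> parcs G"
      then show thesis using assms(2) by (intro that[of "[(u, v)]"]) (auto simp: awalk_def)
    next
      fix w assume "(u, w) \<in> parcs G" "(w, v) \<in> parcs G"
      then show thesis using assms(2) by (intro that[of "[(u, w), (w, v)]"]) (auto simp: awalk_def)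
    qed
    then have "graph_dist G u v \<le> ereal (length p)" "ereal (length p) \<le> ereal 2"
      using min_cost_le_walk_cost[of u p v "\<lambda>_. 1"] by (auto simp: graph_dist_def cost)
    then show "graph_dist G u v \<le> 2"
      using order_trans by fastforce
  qed
qed

lemma graph_square_nat_graph:
  "graph_square (nat_graph n A) = nat_graph n (matrix_square n A)"
proof -
  have "graph_dist (nat_graph n A) u v \<le> 2 \<longleftrightarrow> A u v \<or> (\<exists>w<n. A u w \<and> A w v)"
    if "u < n" "v < n" "u \<noteq> v" for u v
    using that by (subst graph_dist_le_2) auto
  then show ?thesis
    by (auto simp: graph_square_def nat_graph_def matrix_square_def)
qed

lemma encode_nat_graph: "encode_graph (nat_graph n A) = encode_matrix n A"
  unfolding encode_graph_def encode_matrix_def Let_def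
  by (auto intro!: arg_cong[where f = concat] map_cong)

lemma squco_nat_graph:
  "squco (nat_graph n A) \<longleftrightarrow> matrix_iso n (matrix_square n A) (matrix_complement A)"
  by (simp add: squco_def graph_square_nat_graph graph_complement_nat_graph graph_iso_nat_graph)

section \<open>The two languages in terms of matrices\<close>

lemma mem_SQUCO_RECOGNITION:
  "w \<in> SQUCO_RECOGNITION \<longleftrightarrow> (\<exists>n A. simple_matrix n A \<and> w = encode_matrix n A \<and>
    matrix_iso n (matrix_square n A) (matrix_complement A))"
    (is "_ \<longleftrightarrow> ?R")
proof
  assume "w \<in> SQUCO_RECOGNITION"
  then obtain G where "w = encode_graph G" "input_graph G" "squco G"
    by (auto simp: SQUCO_RECOGNITION_def)
  moreover from \<open>input_graph G\<close> obtain n A where "simple_matrix n A" "G = nat_graph n A"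
    by (rule input_graphE)
  ultimately show ?R
    by (intro exI[of _ n] exI[of _ A]) (simp add: encode_nat_graph squco_nat_graph)
next
  assume ?R
  then obtain n A where "simple_matrix n A" "w = encode_matrix n A"
    "matrix_iso n (matrix_square n A) (matrix_complement A)"
    by blast
  then show "w \<in> SQUCO_RECOGNITION"
    unfolding SQUCO_RECOGNITION_def mem_Collect_eq
    by (intro exI[of _ "nat_graph n A"])
      (simp add: encode_nat_graph squco_nat_graph input_graph_nat_graph)
qed

lemma mem_GRAPH_ISOMORPHISM:
  "w \<in> GRAPH_ISOMORPHISM \<longleftrightarrow> (\<exists>n A B. simple_matrix n A \<and> simple_matrix n B \<and>
    w = encode_matrix n A @ encode_matrix n B \<and> matrix_iso n A B)"
    (is "_ \<longleftrightarrow> ?R")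
proof
  assume "w \<in> GRAPH_ISOMORPHISM"
  then obtain G H where w: "w = encode_graph G @ encode_graph H"
    and "input_graph G" "input_graph H" and iso: "graph_iso G H"
    by (auto simp: GRAPH_ISOMORPHISM_def)
  then obtain n A m B where G: "simple_matrix n A" "G = nat_graph n A"
    and H: "simple_matrix m B" "H = nat_graph m B"
    by (metis input_graphE)
  from w iso have "w = encode_matrix n A @ encode_matrix n B" "n = m" "matrix_iso n A B"
    by (auto simp: G H encode_nat_graph graph_iso_nat_graph)
  with G H show ?R
    by blast
next
  assume ?R
  then obtain n A B where "simple_matrix n A" "simple_matrix n B"
    "w = encode_matrix n A @ encode_matrix n B" "matrix_iso n A B"
    by blast
  then show "w \<in> GRAPH_ISOMORPHISM"
    unfolding GRAPH_ISOMORPHISM_def mem_Collect_eq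
    by (intro exI[of _ "nat_graph n A"] exI[of _ "nat_graph n B"])
      (simp add: encode_nat_graph graph_iso_nat_graph input_graph_nat_graph)
qed

lemma matrix_iso_cong:
  assumes "\<And>u v. u < n \<Longrightarrow> v < n \<Longrightarrow> A u v \<longleftrightarrow> A' u v"
    and "\<And>u v. u < n \<Longrightarrow> v < n \<Longrightarrow> B u v \<longleftrightarrow> B' u v"
  shows "matrix_iso n A B \<longleftrightarrow> matrix_iso n A' B'"
proof -
  have "f u < n" if "bij_betw f {..<n} {..<n}" "u < n" for f u
    using bij_betw_apply[OF that(1)] that(2) by blast
  then show ?thesis
    using assms unfolding matrix_iso_def by (intro ex_cong1 conj_cong all_cong1 imp_cong refl) auto
qed

text \<open>A bijection preserves distinctness of indices, so off the diagonal both sides are merely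
  negated, and on the diagonal all four matrices are false.\<close>

lemma matrix_iso_complement:
  assumes "\<And>u. \<not> A u u" "\<And>u. \<not> B u u"
  shows "matrix_iso n (matrix_complement A) (matrix_complement B) \<longleftrightarrow> matrix_iso n A B"
proof -
  have "f u = f v \<longleftrightarrow> u = v" if "bij_betw f {..<n} {..<n}" "u < n" "v < n" for f u v
    using that by (meson bij_betw_imp_inj_on inj_on_eq_iff lessThan_iff)
  then have "(matrix_complement A u v \<longleftrightarrow> matrix_complement B (f u) (f v)) \<longleftrightarrow>
      (A u v \<longleftrightarrow> B (f u) (f v))"
    if "bij_betw f {..<n} {..<n}" "u < n" "v < n" for f u v
    using that assms unfolding matrix_complement_def by metis
  then show ?thesis
    unfolding matrix_iso_def by (intro ex_cong1 conj_cong all_cong1 imp_cong refl) auto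
qed

definition vertex_degree :: "nat \<Rightarrow> (nat \<Rightarrow> nat \<Rightarrow> bool) \<Rightarrow> nat \<Rightarrow> nat" where
  "vertex_degree n A u = card {v. v < n \<and> A u v}"

lemma vertex_degree_iso:
  assumes f: "bij_betw f {..<n} {..<n}"
    and iso: "\<And>u v. u < n \<Longrightarrow> v < n \<Longrightarrow> A u v \<longleftrightarrow> B (f u) (f v)" and u: "u < n"
  shows "vertex_degree n B (f u) = vertex_degree n A u"
proof -
  have img: "f ` {..<n} = {..<n}" and inj: "inj_on f {..<n}"
    using f by (auto simp: bij_betw_def)
  have "{v. v < n \<and> B (f u) v} = f ` {v. v < n \<and> A u v}"
  proof (intro equalityI subsetI)
    fix w assume w: "w \<in> {v. v < n \<and> B (f u) v}"
    then have "w \<in> f ` {..<n}" by (simp add: img)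
    then obtain v where "v < n" "w = f v" by auto
    with w iso u show "w \<in> f ` {v. v < n \<and> A u v}" by auto
  next
    fix w assume "w \<in> f ` {v. v < n \<and> A u v}"
    then show "w \<in> {v. v < n \<and> B (f u) v}"
      using iso u bij_betw_apply[OF f] by auto
  qed
  moreover have "inj_on f {v. v < n \<and> A u v}"
    using inj by (rule inj_on_subset) auto
  ultimately show ?thesis
    unfolding vertex_degree_def by (simp add: card_image)
qed

section \<open>Bipartite graphs\<close>

text \<open>Rows are the vertices below \<open>a\<close>, and column \<open>q\<close> is the vertex
  \<open>a + q\<close>. The number of columns is fixed only by the vertex count of the surrounding
  graph.\<close>

definition bipartite :: "nat \<Rightarrow> (nat \<Rightarrow> nat \<Rightarrow> bool) \<Rightarrow> nat \<Rightarrow> nat \<Rightarrow> bool" where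
  "bipartite a E u v \<longleftrightarrow> (u < a \<and> a \<le> v \<and> E u (v - a)) \<or> (v < a \<and> a \<le> u \<and> E v (u - a))"

lemma bipartite_irrefl: "\<not> bipartite a E u u"
  by (auto simp: bipartite_def)

lemma simple_matrix_bipartite: "simple_matrix n (bipartite a E)"
  by (auto simp: simple_matrix_def bipartite_def)

text \<open>Two vertices of one side are adjacent in the square through their common neighbour. A
  walk of two edges never joins different sides, so the square adds nothing there. The complement of
  the bipartite complement is likewise complete on each side and agrees with \<open>E\<close>
  between the sides.\<close>

lemma matrix_square_bipartite:
  assumes rows: "\<And>u u'. u < a \<Longrightarrow> u' < a \<Longrightarrow> \<exists>q<b. E u q \<and> E u' q"
    and cols: "\<And>q q'. q < b \<Longrightarrow> q' < b \<Longrightarrow> \<exists>u<a. E u q \<and> E u q'"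
    and uv: "u < a + b" "v < a + b"
  shows "matrix_square (a + b) (bipartite a E) u v \<longleftrightarrow>
    matrix_complement (bipartite a (\<lambda>u q. \<not> E u q)) u v"
proof -
  consider (rows) "u < a" "v < a" | (cols) "a \<le> u" "a \<le> v" | (mixed) "u < a \<longleftrightarrow> a \<le> v"
    by linarith
  then show ?thesis
  proof cases
    case rows
    then obtain q where "q < b" "E u q" "E v q" using assms(1) by blast
    then have "\<exists>w<a + b. bipartite a E u w \<and> bipartite a E w v"
      using rows by (intro exI[of _ "a + q"]) (auto simp: bipartite_def)
    then show ?thesis
      using rows by (auto simp: matrix_square_def matrix_complement_def bipartite_def)
  next
    case cols
    then have "u - a < b" "v - a < b" using uv by auto
    then obtain w where "w < a" "E w (u - a)" "E w (v - a)" using assms(2) by blast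
    then have "\<exists>w<a + b. bipartite a E u w \<and> bipartite a E w v"
      using cols by (intro exI[of _ w]) (auto simp: bipartite_def)
    then show ?thesis
      using cols by (auto simp: matrix_square_def matrix_complement_def bipartite_def)
  next
    case mixed
    then have "\<not> (bipartite a E u w \<and> bipartite a E w v)" for w
      by (auto simp: bipartite_def)
    then show ?thesis
      using mixed by (auto simp: matrix_square_def matrix_complement_def bipartite_def)
  qed
qed

text \<open>Taking complements at both ends turns an isomorphism from the square to the complement
  into one from the bipartite complement to the graph itself.\<close>

lemma squco_bipartite:
  assumes "\<And>u u'. u < a \<Longrightarrow> u' < a \<Longrightarrow> \<exists>q<b. E u q \<and> E u' q"
    and "\<And>q q'. q < b \<Longrightarrow> q' < b \<Longrightarrow> \<exists>u<a. E u q \<and> E u q'"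
  shows "matrix_iso (a + b) (matrix_square (a + b) (bipartite a E)) (matrix_complement (bipartite a E))
    \<longleftrightarrow> matrix_iso (a + b) (bipartite a (\<lambda>u q. \<not> E u q)) (bipartite a E)"
  using matrix_iso_cong[OF matrix_square_bipartite[OF assms] refl]
  by (simp add: matrix_iso_complement bipartite_irrefl)

lemma bipartite_iso:
  assumes r: "bij_betw r {..<a} {..<a}" and k: "bij_betw k {..<b} {..<b}"
    and iso: "\<And>u q. u < a \<Longrightarrow> q < b \<Longrightarrow> E u q \<longleftrightarrow> E' (r u) (k q)"
  shows "matrix_iso (a + b) (bipartite a E) (bipartite a E')"
proof -
  define f where "f v = (if v < a then r v else a + k (v - a))" for v
  have r': "r u < a" if "u < a" for u using bij_betw_apply[OF r] that by blast
  have k': "k q < b" if "q < b" for q using bij_betw_apply[OF k] that by blast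
  have "bij_betw f {..<a + b} {..<a + b}"
  proof -
    have "f ` {..<a + b} \<subseteq> {..<a + b}"
      using r' k' by (auto simp: f_def trans_less_add1)
    moreover have "inj_on f {..<a + b}"
    proof (rule inj_onI)
      fix u v assume uv: "u \<in> {..<a + b}" "v \<in> {..<a + b}" and eq: "f u = f v"
      have "u < a \<longleftrightarrow> v < a"
        using eq r'[of u] r'[of v] by (auto simp: f_def split: if_splits)
      moreover have "u = v" if "u < a" "v < a"
        using that eq r by (auto simp: f_def dest: bij_betw_imp_inj_on inj_onD)
      moreover have "u - a = v - a" if "a \<le> u" "a \<le> v"
      proof (rule inj_onD[OF bij_betw_imp_inj_on[OF k]])
        show "k (u - a) = k (v - a)" using that eq by (simp add: f_def)
      qed (use that uv in auto)
      ultimately show "u = v" by force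
    qed
    ultimately show ?thesis
      by (simp add: bij_betw_def endo_inj_surj)
  qed
  moreover have "bipartite a E u v \<longleftrightarrow> bipartite a E' (f u) (f v)"
    if "u < a + b" "v < a + b" for u v
    using that iso[of u "v - a"] iso[of v "u - a"] r'[of u] r'[of v]
    by (auto simp: bipartite_def f_def)
  ultimately show ?thesis unfolding matrix_iso_def by blast
qed

section \<open>The gadget\<close>

text \<open>The column of the pair \<open>(j, k)\<close> has number \<open>j * n + k\<close>. All
  ordered pairs get a column, so that the number of columns does not depend on \<open>A\<close>.
  Bounded quantifiers stand in place of division and remainder because they are what is later
  compiled to programs.\<close>

definition incidence :: "nat \<Rightarrow> (nat \<Rightarrow> nat \<Rightarrow> bool) \<Rightarrow> nat \<Rightarrow> nat \<Rightarrow> bool" where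
  "incidence n A i q \<longleftrightarrow> (\<exists>j<n. \<exists>k<n. q = j * n + k \<and> (i = j \<or> i = k \<and> A j k))"

lemma pair_code_eq_iff:
  fixes j k :: nat
  assumes "k < n" "k' < n"
  shows "j * n + k = j' * n + k' \<longleftrightarrow> j = j' \<and> k = k'"
proof
  assume eq: "j * n + k = j' * n + k'"
  moreover have "(j * n + k) div n = j" "(j' * n + k') div n = j'"
    using assms by simp_all
  ultimately show "j = j' \<and> k = k'" by simp
qed simp

lemma pair_code_less:
  fixes j k :: nat
  assumes "j < n" "k < n"
  shows "j * n + k < n * n"
proof -
  have "j * n + k < Suc j * n" using assms by simp
  also have "\<dots> \<le> n * n" using assms by (intro mult_right_mono) auto
  finally show ?thesis .
qed

lemma pair_codeE:
  fixes q :: nat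
  assumes "q < n * n"
  obtains j k where "j < n" "k < n" "q = j * n + k"
proof
  show "q div n < n" using assms by (simp add: less_mult_imp_div_less)
  show "q mod n < n" using assms by (cases n) auto
  show "q = q div n * n + q mod n" by simp
qed

lemma incidence_pair:
  "j < n \<Longrightarrow> k < n \<Longrightarrow> incidence n A i (j * n + k) \<longleftrightarrow> i = j \<or> i = k \<and> A j k"
  unfolding incidence_def by (auto simp: pair_code_eq_iff)

text \<open>
  Row \<open>u\<close> lies in \<open>X\<^sub>1\<close> if \<open>u < n\<close>, in \<open>X\<^sub>2\<close> if \<open>n \<le> u < 2n\<close>, and in \<open>X\<^sub>0\<close> otherwise; column \<open>q\<close> lies in
  \<open>Y\<^sub>1\<close> if \<open>q < n\<^sup>2\<close>, in \<open>Y\<^sub>2\<close> if \<open>n\<^sup>2 \<le> q < 2n\<^sup>2\<close>, and in \<open>Y\<^sub>0\<close> otherwise.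
\<close>

definition gadget ::
    "nat \<Rightarrow> (nat \<Rightarrow> nat \<Rightarrow> bool) \<Rightarrow> (nat \<Rightarrow> nat \<Rightarrow> bool) \<Rightarrow> nat \<Rightarrow> nat \<Rightarrow> bool" where
  "gadget n A B u q \<longleftrightarrow>
    (if q < n * n then (if u < n then incidence n A u q else 2 * n \<le> u)
     else if q < 2 * (n * n) then u < n \<or> (u < 2 * n \<and> \<not> incidence n B (u - n) (q - n * n))
     else if u < 2 * n then n \<le> u else u + 2 * (n * n) = q + 2 * n)"

abbreviation gadget_graph where
  "gadget_graph n A B \<equiv> bipartite (2 * n + 2) (gadget n A B)"

abbreviation gadget_size where
  "gadget_size n \<equiv> (2 * n + 2) + (2 * (n * n) + 2)"

section \<open>Common neighbours on each side of the gadget\<close>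

lemma exists_third:
  assumes "3 \<le> (n::nat)"
  obtains i where "i < n" "i \<noteq> j" "i \<noteq> k"
proof -
  have "card {j, k} < card {..<n}" using assms by (simp add: card_insert_if)
  then have "\<not> {..<n} \<subseteq> {j, k}" by (meson card_mono finite.emptyI finite.insertI not_le)
  with that show thesis by auto
qed

text \<open>Each block of rows is complete to one block of columns, which serves two rows of the
  same block. For rows of different blocks, one of them is complete to the column block carrying the
  special graph of the other, and any neighbour of the other in that block is common to
  both.\<close>

lemma gadget_rows:
  assumes n: "3 \<le> n" and B: "simple_matrix n B" and "u < 2 * n + 2" "u' < 2 * n + 2"
  shows "\<exists>q < 2 * (n * n) + 2. gadget n A B u q \<and> gadget n A B u' q"
  using assms(3,4)
proof (induction u u' rule: linorder_wlog)
  case (le u u')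
  have nn: "0 < n * n" using n by simp
  consider (a) "u' < n" | (b) "u < n" "n \<le> u'" "u' < 2 * n" | (c) "u < n" "2 * n \<le> u'"
    | (d) "n \<le> u" "u < 2 * n" "u' < 2 * n" | (e) "n \<le> u" "u < 2 * n" "2 * n \<le> u'"
    | (f) "2 * n \<le> u"
    using le by linarith
  then show ?case
  proof cases
    case a
    then show ?thesis using le nn by (intro exI[of _ "n * n"]) (auto simp: gadget_def)
  next
    case b
    \<comment> \<open>The column of \<open>(j, j)\<close> in \<open>Y\<^sub>2\<close> misses only
      row \<open>n + j\<close> of \<open>X\<^sub>2\<close>.\<close>
    obtain j where j: "j < n" "j \<noteq> u' - n" using exists_third[OF n] by metis
    have "\<not> B j j" using B j by (auto simp: simple_matrix_def)
    with j b show ?thesis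
      using pair_code_less[of j n j]
      by (intro exI[of _ "n * n + (j * n + j)"]) (auto simp: gadget_def incidence_pair)
  next
    case c
    then show ?thesis using pair_code_less[of u n u]
      by (intro exI[of _ "u * n + u"]) (auto simp: gadget_def incidence_pair)
  next
    case d
    then show ?thesis using le by (intro exI[of _ "2 * (n * n)"]) (auto simp: gadget_def)
  next
    case e
    then show ?thesis using le(3)
      by (intro exI[of _ "2 * (n * n) + (u' - 2 * n)"]) (auto simp: gadget_def)
  next
    case f
    then show ?thesis using le nn by (intro exI[of _ 0]) (auto simp: gadget_def)
  qed
next
  case (sym u u')
  then show ?case by blast
qed

text \<open>This is the block argument for rows with the sides exchanged: columns of one block share
  a complete row block, and of two columns in different blocks one is complete to the special row
  block of the other.\<close>

lemma gadget_cols: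
  assumes n: "3 \<le> n" and "q < 2 * (n * n) + 2" "q' < 2 * (n * n) + 2"
  shows "\<exists>u < 2 * n + 2. gadget n A B u q \<and> gadget n A B u q'"
  using assms(2,3)
proof (induction q q' rule: linorder_wlog)
  case (le q q')
  let ?m = "n * n"
  consider (a) "q' < ?m" | (b) "q < ?m" "?m \<le> q'" "q' < 2 * ?m" | (c) "q < ?m" "2 * ?m \<le> q'"
    | (d) "?m \<le> q" "q < 2 * ?m" "q' < 2 * ?m" | (e) "?m \<le> q" "q < 2 * ?m" "2 * ?m \<le> q'"
    | (f) "2 * ?m \<le> q"
    using le by linarith
  then show ?case
  proof cases
    case a
    then show ?thesis using le by (intro exI[of _ "2 * n"]) (auto simp: gadget_def)
  next
    case b
    then obtain j k where "j < n" "k < n" "q = j * n + k" by (auto elim: pair_codeE)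
    with b show ?thesis by (intro exI[of _ j]) (auto simp: gadget_def incidence_pair)
  next
    case c
    then show ?thesis using le(3)
      by (intro exI[of _ "2 * n + (q' - 2 * ?m)"]) (auto simp: gadget_def)
  next
    case d
    then show ?thesis using le n by (intro exI[of _ 0]) (auto simp: gadget_def)
  next
    case e
    then have "q - ?m < n * n" by linarith
    then obtain j k where jk: "j < n" "k < n" "q - ?m = j * n + k" by (rule pair_codeE)
    \<comment> \<open>In the bipartite complement of the incidence graph, column
      \<open>(j, k)\<close> is adjacent to all rows except that of \<open>j\<close> and possibly
      that of \<open>k\<close>; an index different from both exists because
      \<open>3 \<le> n\<close>.\<close>
    obtain i where i: "i < n" "i \<noteq> j" "i \<noteq> k" by (rule exists_third[OF n])
    with e jk show ?thesis
      by (intro exI[of _ "n + i"]) (auto simp: gadget_def incidence_pair)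
  next
    case f
    then show ?thesis using le n by (intro exI[of _ n]) (auto simp: gadget_def)
  qed
next
  case (sym q q')
  then show ?case by blast
qed

section \<open>Maps between gadgets\<close>

lemma bij_betw_lessThan_involution:
  assumes "\<And>x. x < n \<Longrightarrow> f x < n" "\<And>x. x < n \<Longrightarrow> f (f x) = x"
  shows "bij_betw f {..<n} {..<n::nat}"
  by (rule bij_betw_byWitness[of _ f]) (use assms in auto)

text \<open>The map \<open>r\<close> exchanges \<open>X\<^sub>1\<close> with
  \<open>X\<^sub>2\<close>, and \<open>k\<close> exchanges \<open>Y\<^sub>1\<close> with
  \<open>Y\<^sub>2\<close>. Complementation swaps complete and empty blocks, which this exchange
  undoes, while the blocks carrying \<open>A\<close> and \<open>B\<close> trade places.\<close>

lemma gadget_complement_iso: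
  "matrix_iso (gadget_size n) (bipartite (2 * n + 2) (\<lambda>u q. \<not> gadget n A B u q))
    (gadget_graph n B A)"
proof (rule bipartite_iso)
  define m where "m = n * n"
  define r where "r u = (if u < n then u + n else if u < 2 * n then u - n else u)" for u
  \<comment> \<open>\<open>4 * m + 1 - q\<close> exchanges the columns \<open>2 * m\<close> and
    \<open>2 * m + 1\<close> of \<open>Y\<^sub>0\<close>: the bipartite complement of a perfect
    matching on two plus two vertices is the other perfect matching.\<close>
  define k where "k q = (if q < m then q + m else if q < 2 * m then q - m else 4 * m + 1 - q)" for q
  show "bij_betw r {..<2 * n + 2} {..<2 * n + 2}"
    by (rule bij_betw_lessThan_involution) (auto simp: r_def)
  show "bij_betw k {..<2 * (n * n) + 2} {..<2 * (n * n) + 2}"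
    unfolding m_def[symmetric] by (rule bij_betw_lessThan_involution) (auto simp: k_def)
  fix u q assume uq: "u < 2 * n + 2" "q < 2 * (n * n) + 2"
  have gadget: "gadget n A B u q \<longleftrightarrow>
    (if q < m then (if u < n then incidence n A u q else 2 * n \<le> u)
     else if q < 2 * m then u < n \<or> (u < 2 * n \<and> \<not> incidence n B (u - n) (q - m))
     else if u < 2 * n then n \<le> u else u + 2 * m = q + 2 * n)" for A B u q
    by (simp add: gadget_def m_def)
  have r: "u < n \<Longrightarrow> r u = u + n" "n \<le> u \<Longrightarrow> u < 2 * n \<Longrightarrow> r u = u - n"
    "2 * n \<le> u \<Longrightarrow> r u = u" "n \<le> u \<Longrightarrow> u < 2 * n \<Longrightarrow> u - n < n"
    by (auto simp: r_def)
  have u: "u < n \<or> n \<le> u \<and> u < 2 * n \<or> 2 * n \<le> u" by linarith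
  consider (1) "q < m" | (2) "m \<le> q" "q < 2 * m" | (3) "q = 2 * m" | (4) "q = 2 * m + 1"
    using uq(2) unfolding m_def[symmetric] by linarith
  then show "\<not> gadget n A B u q \<longleftrightarrow> gadget n B A (r u) (k q)"
  proof cases
    case 1
    then have "k q = q + m" by (simp add: k_def)
    with 1 u show ?thesis by (elim disjE conjE) (simp_all add: gadget r)
  next
    case 2
    then have "k q = q - m" "q - m < m" by (auto simp: k_def)
    with 2 u show ?thesis by (elim disjE conjE) (simp_all add: gadget r)
  next
    case 3
    then have "k q = q + 1" by (simp add: k_def)
    with 3 u uq(1) show ?thesis by (elim disjE conjE) (auto simp: gadget r)
  next
    case 4
    then have "k q = q - 1" by (simp add: k_def)
    with 4 u uq(1) show ?thesis by (elim disjE conjE) (auto simp: gadget r)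
  qed
qed

text \<open>An isomorphism \<open>f\<close> acts on \<open>X\<^sub>1\<close> directly and on
  \<open>Y\<^sub>1\<close> by sending the column of \<open>(i, j)\<close> to that of
  \<open>(f i, f j)\<close>; all else stays fixed. The conclusion speaks of row and column maps
  rather than of graphs because the same maps are later used for the bipartite complements
  too.\<close>

lemma gadget_iso_left:
  assumes "matrix_iso n A A'"
  shows "\<exists>r k. bij_betw r {..<2 * n + 2} {..<2 * n + 2} \<and>
    bij_betw k {..<2 * (n * n) + 2} {..<2 * (n * n) + 2} \<and>
    (\<forall>u < 2 * n + 2. \<forall>q < 2 * (n * n) + 2. gadget n A B u q \<longleftrightarrow> gadget n A' B (r u) (k q))"
proof -
  let ?m = "n * n"
  obtain f where f: "bij_betw f {..<n} {..<n}"
    and A: "\<And>u v. u < n \<Longrightarrow> v < n \<Longrightarrow> A u v \<longleftrightarrow> A' (f u) (f v)"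
    using assms unfolding matrix_iso_def by blast
  have fless: "f u < n" if "u < n" for u using bij_betw_apply[OF f] that by blast
  have finj: "f u = f v \<longleftrightarrow> u = v" if "u < n" "v < n" for u v
    using inj_onD[OF bij_betw_imp_inj_on[OF f]] that by auto
  define r where "r u = (if u < n then f u else u)" for u
  define k where "k q = (if q < ?m then f (q div n) * n + f (q mod n) else q)" for q
  have kpair: "k (i * n + j) = f i * n + f j" if "i < n" "j < n" for i j
    using that by (simp add: k_def pair_code_less)
  have kless: "k q < ?m" if q: "q < ?m" for q
    using q by (auto elim!: pair_codeE simp: kpair pair_code_less fless)
  have "inj_on r {..<2 * n + 2}"
    using finj fless by (auto simp: inj_on_def r_def)
  moreover have "r ` {..<2 * n + 2} \<subseteq> {..<2 * n + 2}"
    using fless by (auto simp: r_def trans_less_add1 less_SucI)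
      (metis fless less_SucI trans_less_add1 mult_2)
  ultimately have "bij_betw r {..<2 * n + 2} {..<2 * n + 2}"
    by (simp add: bij_betw_def endo_inj_surj)
  moreover have "inj_on k {..<2 * ?m + 2}"
  proof (rule inj_onI)
    fix p q assume eq: "k p = k q"
    have "p < ?m \<longleftrightarrow> q < ?m"
      using eq kless[of p] kless[of q] by (auto simp: k_def split: if_splits)
    moreover have "p = q" if "p < ?m" "q < ?m"
    proof -
      obtain i j i' j' where "i < n" "j < n" "p = i * n + j" "i' < n" "j' < n" "q = i' * n + j'"
        using \<open>p < ?m\<close> \<open>q < ?m\<close> by (metis pair_codeE)
      with eq show ?thesis by (simp add: kpair pair_code_eq_iff fless finj)
    qed
    ultimately show "p = q" using eq by (auto simp: k_def)
  qed
  moreover have "k ` {..<2 * ?m + 2} \<subseteq> {..<2 * ?m + 2}"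
  proof
    fix x assume "x \<in> k ` {..<2 * ?m + 2}"
    then obtain q where "q < 2 * ?m + 2" "x = k q" by auto
    with kless[of q] show "x \<in> {..<2 * ?m + 2}"
      by (cases "q < ?m") (auto simp: k_def)
  qed
  moreover have "gadget n A B u q \<longleftrightarrow> gadget n A' B (r u) (k q)" for u q
  proof -
    have "incidence n A u q \<longleftrightarrow> incidence n A' (f u) (k q)" if "u < n" "q < ?m"
    proof -
      obtain i j where "i < n" "j < n" "q = i * n + j"
        using \<open>q < ?m\<close> by (rule pair_codeE)
      with that A show ?thesis by (simp add: kpair incidence_pair fless finj)
    qed
    moreover have "k q = q" if "\<not> q < ?m" using that by (simp add: k_def)
    moreover have "r u = f u" "f u < n" if "u < n" using that fless by (auto simp: r_def)
    moreover have "r u = u" if "\<not> u < n" using that by (simp add: r_def)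
    ultimately show ?thesis
      using kless[of q] by (cases "u < n"; cases "q < ?m") (auto simp: gadget_def)
  qed
  ultimately show ?thesis
    by (intro exI[of _ r] exI[of _ k]) (simp add: bij_betw_def endo_inj_surj)
qed

text \<open>Degrees separate \<open>X\<^sub>1\<close> from the rest. A row of
  \<open>X\<^sub>1\<close> sees all of \<open>Y\<^sub>2\<close> and at least two columns of
  \<open>Y\<^sub>1\<close>. A row of \<open>X\<^sub>2\<close> misses a column of
  \<open>Y\<^sub>2\<close>, so it has at most \<open>n * n - 1 + 2\<close> neighbours; a row of
  \<open>X\<^sub>0\<close> has at most \<open>n * n + 1\<close>; a column has at most
  \<open>2 * n + 2\<close>, which is below \<open>n * n + 2\<close> as
  \<open>3 * n \<le> n * n\<close>.\<close>

lemma gadget_degree: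
  assumes n: "3 \<le> n" and B: "simple_matrix n B" and v: "v < gadget_size n"
  shows "n * n + 2 \<le> vertex_degree (gadget_size n) (gadget_graph n A B) v \<longleftrightarrow> v < n"
proof -
  let ?m = "n * n" and ?a = "2 * n + 2"
  let ?N = "{w. w < gadget_size n \<and> gadget_graph n A B v w}"
  have fin: "finite ?N" by simp
  have "3 * n \<le> ?m" using n by (rule mult_right_mono) simp
  show ?thesis
  proof
    assume vn: "v < n"
    \<comment> \<open>\<open>k\<close> is some index other than \<open>v\<close>, so that the
      columns of \<open>(v, v)\<close> and \<open>(v, k)\<close> are two distinct neighbours of
      \<open>v\<close>.\<close>
    define k where "k = (if v = 0 then 1 else 0 :: nat)"
    have k: "k < n" "k \<noteq> v" using n by (auto simp: k_def)
    let ?S = "insert (?a + (v * n + v)) (insert (?a + (v * n + k)) {?a + ?m..<?a + 2 * ?m})"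
    have lt: "v * n + v < ?m" "v * n + k < ?m"
      using vn k by (auto intro: pair_code_less)
    have "?S \<subseteq> ?N"
      using lt vn k by (auto simp: bipartite_def gadget_def incidence_pair)
    from card_mono[OF fin this] have "card ?S \<le> vertex_degree (gadget_size n) (gadget_graph n A B) v"
      by (simp add: vertex_degree_def)
    moreover have "card ?S = ?m + 2" using lt k by (simp add: card_insert_if)
    ultimately show "?m + 2 \<le> vertex_degree (gadget_size n) (gadget_graph n A B) v" by simp
  next
    assume le: "?m + 2 \<le> vertex_degree (gadget_size n) (gadget_graph n A B) v"
    have bound: "vertex_degree (gadget_size n) (gadget_graph n A B) v \<le> card S"
      if "finite S" "?N \<subseteq> S" for S
      using card_mono[OF that] by (simp add: vertex_degree_def)
    show "v < n"
    proof (rule ccontr)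
      assume "\<not> v < n"
      then consider (X2) "n \<le> v" "v < 2 * n" | (X0) "2 * n \<le> v" "v < ?a" | (Y) "?a \<le> v"
        by linarith
      then show False
      proof cases
        case X2
        then obtain i where i: "v = n + i" "i < n" by (metis le_Suc_ex add_less_cancel_left mult_2)
        \<comment> \<open>\<open>p\<close> is the pair \<open>(i, i)\<close>, whose column in
          \<open>Y\<^sub>2\<close> the row misses.\<close>
        define p where "p = i * n + i"
        have lt: "p < ?m" using i by (simp add: p_def pair_code_less)
        have inc: "incidence n B i p" using i by (simp add: p_def incidence_pair)
        let ?d = "?a + (?m + p)"
        let ?S = "{?a + ?m..<?a + 2 * ?m + 2} - {?d}"
        have "?N \<subseteq> ?S"
        proof
          fix w assume w: "w \<in> ?N"
          with X2 have a: "?a \<le> w" and g: "gadget n A B v (w - ?a)"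
            by (auto simp: bipartite_def)
          have "\<not> gadget n A B v (?m + p)"
            using i lt inc by (simp add: gadget_def)
          with g have "w \<noteq> ?d" by auto
          moreover have "?m \<le> w - ?a" using g X2 by (auto simp: gadget_def split: if_splits)
          ultimately show "w \<in> ?S" using w a by auto
        qed
        then have "vertex_degree (gadget_size n) (gadget_graph n A B) v \<le> card ?S"
          by (intro bound) auto
        also have "\<dots> = ?m + 1" using lt by (subst card_Diff_singleton) auto
        finally show False using le by simp
      next
        case X0
        let ?S = "insert (?a + 2 * ?m + (v - 2 * n)) {?a..<?a + ?m}"
        have "?N \<subseteq> ?S"
          using X0 by (auto simp: bipartite_def gadget_def split: if_splits)
        then have "vertex_degree (gadget_size n) (gadget_graph n A B) v \<le> card ?S"
          by (intro bound) auto
        also have "\<dots> \<le> ?m + 1" by (simp add: card_insert_if)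
        finally show False using le by simp
      next
        case Y
        then have "?N \<subseteq> {..<?a}" by (auto simp: bipartite_def)
        then have "vertex_degree (gadget_size n) (gadget_graph n A B) v \<le> card {..<?a}"
          by (intro bound) auto
        with le n \<open>3 * n \<le> ?m\<close> show False unfolding card_lessThan by linarith
      qed
    qed
  qed
qed

text \<open>Both gadgets have the same degree threshold, so \<open>f\<close> preserves
  \<open>X\<^sub>1\<close>. An edge \<open>ij\<close> yields a column whose neighbours in
  \<open>X\<^sub>1\<close> are exactly \<open>i\<close> and \<open>j\<close>; its image has exactly
  \<open>f i\<close> and \<open>f j\<close> there. Columns of \<open>Y\<^sub>2\<close> see at least
  three rows of \<open>X\<^sub>1\<close> and those of \<open>Y\<^sub>0\<close> none, so the image
  lies in \<open>Y\<^sub>1\<close> and comes from an edge.\<close>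

lemma gadget_iso_edge:
  assumes n: "3 \<le> n" and A': "simple_matrix n A'" and B: "simple_matrix n B" "simple_matrix n B'"
    and f: "bij_betw f {..<gadget_size n} {..<gadget_size n}"
    and iso: "\<And>u v. u < gadget_size n \<Longrightarrow> v < gadget_size n \<Longrightarrow>
      gadget_graph n A B u v \<longleftrightarrow> gadget_graph n A' B' (f u) (f v)"
  shows "bij_betw f {..<n} {..<n}"
    and "i < n \<Longrightarrow> j < n \<Longrightarrow> i \<noteq> j \<Longrightarrow> A i j \<Longrightarrow> A' (f i) (f j)"
proof -
  let ?m = "n * n" and ?a = "2 * n + 2"
  have fless: "f v < gadget_size n" if "v < gadget_size n" for v
    using bij_betw_apply[OF f] that by blast
  have fn: "f v < n \<longleftrightarrow> v < n" if v: "v < gadget_size n" for v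
    using gadget_degree[OF n B(1) v, of A] gadget_degree[OF n B(2) fless[OF v], of A']
      vertex_degree_iso[OF f, of "gadget_graph n A B" "gadget_graph n A' B'" v] iso v by simp
  have img: "f ` {..<gadget_size n} = {..<gadget_size n}" and inj: "inj_on f {..<gadget_size n}"
    using f by (auto simp: bij_betw_def)
  have "f ` {..<n} = {..<n}"
  proof (intro equalityI subsetI)
    fix x assume "x \<in> f ` {..<n}"
    then obtain v where "v < n" "x = f v" by auto
    with fn[of v] show "x \<in> {..<n}" by simp
  next
    fix x assume x: "x \<in> {..<n}"
    then have "x \<in> f ` {..<gadget_size n}" unfolding img by simp
    then obtain v where "v < gadget_size n" "x = f v" by auto
    with fn[of v] x show "x \<in> f ` {..<n}" by simp
  qed
  moreover have "inj_on f {..<n}" using inj by (rule inj_on_subset) auto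
  ultimately show bij: "bij_betw f {..<n} {..<n}" by (simp add: bij_betw_def)
  assume ij: "i < n" "j < n" "i \<noteq> j" and A: "A i j"
  let ?y = "?a + (i * n + j)"
  have lt: "i * n + j < ?m" using ij by (intro pair_code_less)
  then have y: "?y < gadget_size n" by simp
  have nbr: "gadget_graph n A' B' x (f ?y) \<longleftrightarrow> x = f i \<or> x = f j" if x: "x < n" for x
  proof -
    obtain u where u: "u < n" "x = f u"
      using x bij by (metis bij_betw_imp_surj_on imageE lessThan_iff)
    have "gadget_graph n A' B' x (f ?y) \<longleftrightarrow> gadget_graph n A B u ?y"
      using iso[of u ?y] u y by simp
    also have "\<dots> \<longleftrightarrow> u = i \<or> u = j"
      using u ij lt A by (auto simp: bipartite_def gadget_def incidence_pair)
    also have "\<dots> \<longleftrightarrow> x = f i \<or> x = f j"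
      using u ij bij_betw_imp_inj_on[OF bij] by (auto dest: inj_onD)
    finally show ?thesis .
  qed
  have fi: "f i < n" and fj: "f j < n" and fij: "f i \<noteq> f j"
    using ij bij by (auto dest: bij_betw_apply bij_betw_imp_inj_on inj_onD)
  \<comment> \<open>Rows are not adjacent to rows, so a vertex with a neighbour in
    \<open>X\<^sub>1\<close> is a column.\<close>
  have ge: "?a \<le> f ?y" using nbr[OF fi] fi by (auto simp: bipartite_def)
  define q where "q = f ?y - ?a"
  have q: "q < 2 * ?m + 2" using fless[OF y] ge by (simp add: q_def)
  have nbr': "gadget n A' B' x q \<longleftrightarrow> x = f i \<or> x = f j" if "x < n" for x
    using nbr[OF that] ge that by (auto simp: bipartite_def q_def)
  have "q < ?m"
  proof (rule ccontr)
    assume "\<not> q < ?m"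
    then consider "?m \<le> q" "q < 2 * ?m" | "2 * ?m \<le> q" by linarith
    then show False
    proof cases
      case 1
      obtain x where "x < n" "x \<noteq> f i" "x \<noteq> f j" by (rule exists_third[OF n])
      with nbr'[of x] 1 show False by (simp add: gadget_def)
    next
      case 2
      with nbr'[OF fi] fi show False by (simp add: gadget_def)
    qed
  qed
  then obtain i' j' where q': "i' < n" "j' < n" "q = i' * n + j'" by (rule pair_codeE)
  \<comment> \<open>Having two distinct neighbours forces \<open>A' i' j'\<close>, with
    \<open>i'\<close> and \<open>j'\<close> being \<open>f i\<close> and \<open>f j\<close> in some
    order.\<close>
  have "x = f i \<or> x = f j \<longleftrightarrow> x = i' \<or> x = j' \<and> A' i' j'" if "x < n" for x
    using nbr'[OF that] that q' \<open>q < ?m\<close> by (simp add: gadget_def incidence_pair)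
  from this[OF fi] this[OF fj] this[OF q'(1)] fij have "A' (f i) (f j) \<or> A' (f j) (f i)"
    by auto
  then show "A' (f i) (f j)" using A' fi fj by (auto simp: simple_matrix_def)
qed

text \<open>The preservation of edges, applied to an isomorphism and to its inverse, gives both
  directions of the equivalence; on the diagonal both matrices are false.\<close>

lemma gadget_iso_imp_iso:
  assumes n: "3 \<le> n" and A: "simple_matrix n A" "simple_matrix n A'"
    and B: "simple_matrix n B" "simple_matrix n B'"
    and "matrix_iso (gadget_size n) (gadget_graph n A B) (gadget_graph n A' B')"
  shows "matrix_iso n A A'"
proof -
  obtain f where f: "bij_betw f {..<gadget_size n} {..<gadget_size n}"
    and iso: "\<And>u v. u < gadget_size n \<Longrightarrow> v < gadget_size n \<Longrightarrow>
      gadget_graph n A B u v \<longleftrightarrow> gadget_graph n A' B' (f u) (f v)"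
    using assms(6) unfolding matrix_iso_def by (elim exE conjE) (rule that, assumption, simp only:)
  have bij: "bij_betw f {..<n} {..<n}"
    by (rule gadget_iso_edge(1)[OF n A(2) B f]) (rule iso)
  have edge: "A i j \<Longrightarrow> A' (f i) (f j)" if "i < n" "j < n" "i \<noteq> j" for i j
    using that by - (rule gadget_iso_edge(2)[OF n A(2) B f], rule iso)
  define g where "g = inv_into {..<gadget_size n} f"
  have g: "bij_betw g {..<gadget_size n} {..<gadget_size n}"
    unfolding g_def using f by (rule bij_betw_inv_into)
  have fg: "f (g u) = u" if "u < gadget_size n" for u
    unfolding g_def by (rule bij_betw_inv_into_right[OF f]) (use that in simp)
  have gf: "g (f u) = u" if "u < gadget_size n" for u
    unfolding g_def by (rule bij_betw_inv_into_left[OF f]) (use that in simp)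
  have gless: "g u < gadget_size n" if "u < gadget_size n" for u
    using bij_betw_apply[OF g] that by blast
  have iso': "gadget_graph n A' B' u v \<longleftrightarrow> gadget_graph n A B (g u) (g v)"
    if "u < gadget_size n" "v < gadget_size n" for u v
    using iso[OF gless[OF that(1)] gless[OF that(2)]] by (simp only: fg that)
  have edge': "A' i j \<Longrightarrow> A (g i) (g j)" if "i < n" "j < n" "i \<noteq> j" for i j
    using that by - (rule gadget_iso_edge(2)[OF n A(1) B(2,1) g], rule iso')
  have "A i j \<longleftrightarrow> A' (f i) (f j)" if ij: "i < n" "j < n" for i j
  proof (cases "i = j")
    case True
    have "f i < n" using bij_betw_apply[OF bij] ij by blast
    then have "\<not> A i i" "\<not> A' (f i) (f i)"
      using A ij unfolding simple_matrix_def by blast+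
    with True show ?thesis by simp
  next
    case False
    have fij: "f i < n" "f j < n" using bij_betw_apply[OF bij] ij by auto
    have gf': "g (f i) = i" "g (f j) = j" using gf ij by auto
    have ne: "f i \<noteq> f j" using False gf' by metis
    from edge'[OF fij ne] have "A' (f i) (f j) \<Longrightarrow> A i j" unfolding gf' .
    with edge[OF ij False] show ?thesis by blast
  qed
  with bij show ?thesis unfolding matrix_iso_def by blast
qed

text \<open>The bipartite complement of the gadget of \<open>A\<close> and \<open>B\<close> is
  isomorphic to the gadget of \<open>B\<close> and \<open>A\<close>. If that is isomorphic to the
  gadget of \<open>A\<close> and \<open>B\<close>, comparing first arguments relates
  \<open>B\<close> to \<open>A\<close>. Conversely, an isomorphism allows \<open>A\<close> to be
  replaced by \<open>B\<close> throughout, and exchanging equal arguments changes nothing.\<close>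

lemma squco_gadget_iff:
  assumes n: "3 \<le> n" and A: "simple_matrix n A" and B: "simple_matrix n B"
  shows "matrix_iso (gadget_size n) (matrix_square (gadget_size n) (gadget_graph n A B))
      (matrix_complement (gadget_graph n A B)) \<longleftrightarrow> matrix_iso n A B"
proof -
  let ?co = "\<lambda>A B. bipartite (2 * n + 2) (\<lambda>u q. \<not> gadget n A B u q)"
  have "matrix_iso (gadget_size n) (?co A B) (gadget_graph n A B) \<longleftrightarrow> matrix_iso n A B"
  proof
    assume "matrix_iso (gadget_size n) (?co A B) (gadget_graph n A B)"
    then have "matrix_iso (gadget_size n) (gadget_graph n B A) (gadget_graph n A B)"
      by (rule matrix_iso_trans[OF matrix_iso_sym[OF gadget_complement_iso]])
    then show "matrix_iso n A B"
      by (rule matrix_iso_sym[OF gadget_iso_imp_iso[OF n B A A B]])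
  next
    assume iso: "matrix_iso n A B"
    obtain r k where "bij_betw r {..<2 * n + 2} {..<2 * n + 2}"
      "bij_betw k {..<2 * (n * n) + 2} {..<2 * (n * n) + 2}"
      "\<And>u q. u < 2 * n + 2 \<Longrightarrow> q < 2 * (n * n) + 2 \<Longrightarrow>
        gadget n A B u q \<longleftrightarrow> gadget n B B (r u) (k q)"
      using gadget_iso_left[OF iso, of B] by blast
    then have iso1: "matrix_iso (gadget_size n) (gadget_graph n A B) (gadget_graph n B B)"
      and iso2: "matrix_iso (gadget_size n) (?co A B) (?co B B)"
      by (intro bipartite_iso[of r _ k]; simp)+
    show "matrix_iso (gadget_size n) (?co A B) (gadget_graph n A B)"
      by (rule matrix_iso_trans[OF iso2 matrix_iso_trans[OF gadget_complement_iso matrix_iso_sym[OF iso1]]])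
  qed
  then show ?thesis
    using squco_bipartite[OF gadget_rows[OF n B] gadget_cols[OF n]] by simp
qed

section \<open>Polynomial-time programs\<close>

lemma poly_nat_mono: "x \<le> y \<Longrightarrow> poly p x \<le> poly p (y::nat)"
  by (induction p) (auto intro: add_mono mult_mono)

text \<open>A total-correctness triple with time bound \<open>B\<close>. Since \<open>Q\<close> may
  itself be a \<open>runs\<close> statement, a sequence is verified from left to right by
  nesting.\<close>

definition runs :: "prog \<Rightarrow> state \<Rightarrow> nat \<Rightarrow> (state \<Rightarrow> bool) \<Rightarrow> bool" where
  "runs c s B Q \<longleftrightarrow> (\<exists>t s'. exec c s t s' \<and> t \<le> B \<and> Q s')"

lemma runs_mono:
  "runs c s B Q \<Longrightarrow> B \<le> C \<Longrightarrow> (\<And>s'. Q s' \<Longrightarrow> R s') \<Longrightarrow> runs c s C R"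
  unfolding runs_def by (meson order_trans)

lemma runs_Skip: "Q s \<Longrightarrow> 1 \<le> B \<Longrightarrow> runs Skip s B Q"
  unfolding runs_def by (blast intro: exec.Skip)

lemma runs_Clear: "Q (s(x := [])) \<Longrightarrow> 1 \<le> B \<Longrightarrow> runs (Clear x) s B Q"
  unfolding runs_def by (blast intro: exec.Clear)

lemma runs_Copy: "Q (s(x := s y)) \<Longrightarrow> 1 \<le> B \<Longrightarrow> runs (Copy x y) s B Q"
  unfolding runs_def by (blast intro: exec.Copy)

lemma runs_Push: "Q (s(x := b # s x)) \<Longrightarrow> 1 \<le> B \<Longrightarrow> runs (Push x b) s B Q"
  unfolding runs_def by (blast intro: exec.Push)

lemma runs_Pop: "Q (s(x := tl (s x))) \<Longrightarrow> 1 \<le> B \<Longrightarrow> runs (Pop x) s B Q"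
  unfolding runs_def by (blast intro: exec.Pop)

lemma runs_Seq:
  assumes "runs c s B (\<lambda>s'. runs d s' C Q)" "B + C \<le> D"
  shows "runs (Seq c d) s D Q"
proof -
  obtain t s' u s'' where "exec c s t s'" "t \<le> B" "exec d s' u s''" "u \<le> C" "Q s''"
    using assms(1) unfolding runs_def by blast
  then have "exec (Seq c d) s (t + u) s''" "t + u \<le> D" "Q s''"
    using assms(2) by (auto intro: exec.Seq)
  then show ?thesis unfolding runs_def by blast
qed

lemma runs_Cond:
  assumes "test_holds b s \<Longrightarrow> runs c s B Q" "\<not> test_holds b s \<Longrightarrow> runs d s B Q" "Suc B \<le> C"
  shows "runs (Cond b c d) s C Q"
proof (cases "test_holds b s")
  case True
  then obtain t s' where "exec c s t s'" "t \<le> B" "Q s'" using assms(1) unfolding runs_def by blast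
  then show ?thesis
    using exec.Cond_True[OF True, of c t s' d] assms(3) unfolding runs_def
    by (intro exI[of _ "Suc t"] exI[of _ s']) simp
next
  case False
  then obtain t s' where "exec d s t s'" "t \<le> B" "Q s'" using assms(2) unfolding runs_def by blast
  then show ?thesis
    using exec.Cond_False[OF False, of d t s' c] assms(3) unfolding runs_def
    by (intro exI[of _ "Suc t"] exI[of _ s']) simp
qed

text \<open>The counter may drop by more than one per round, which allows an early exit.\<close>

lemma runs_Loop:
  assumes step: "\<And>m s. I (Suc m) s \<Longrightarrow> runs c s B (\<lambda>s'. \<exists>m'\<le>m. I m' s')"
    and len: "\<And>m s. I m s \<Longrightarrow> length (s x) = m"
    and "I m s" and "m * (B + 1) + 1 \<le> C" and Q: "\<And>s'. I 0 s' \<Longrightarrow> Q s'"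
  shows "runs (Loop (Nonempty x) c) s C Q"
proof -
  \<comment> \<open>Each round costs at most \<open>B\<close> steps plus one for its test; the final
    failing test is the last summand.\<close>
  have "\<exists>t s'. exec (Loop (Nonempty x) c) s t s' \<and> t \<le> m * (B + 1) + 1 \<and> I 0 s'"
    using assms(3)
  proof (induction m arbitrary: s rule: less_induct)
    case (less m)
    show ?case
    proof (cases m)
      case 0
      then have "\<not> test_holds (Nonempty x) s" using len[OF less.prems] by simp
      from exec.Loop_False[OF this, of c] 0 less.prems show ?thesis by fastforce
    next
      case (Suc n)
      then obtain t s' m' where c: "exec c s t s'" "t \<le> B" and m': "m' \<le> n" "I m' s'"
        using step less.prems unfolding runs_def by blast
      then obtain u s'' where d: "exec (Loop (Nonempty x) c) s' u s''"
        "u \<le> m' * (B + 1) + 1" "I 0 s''"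
        using less.IH[of m' s'] Suc by auto
      have "test_holds (Nonempty x) s" using len[OF less.prems] Suc by auto
      then have "exec (Loop (Nonempty x) c) s (Suc (t + u)) s''"
        using c(1) d(1) by (rule exec.Loop_True)
      moreover have "m' * (B + 1) \<le> n * (B + 1)" using m'(1) by (rule mult_right_mono) simp
      then have "Suc (t + u) \<le> m * (B + 1) + 1"
        using c(2) d(2) Suc by simp
      ultimately show ?thesis using d(3) by blast
    qed
  qed
  then show ?thesis using assms(4) Q unfolding runs_def by (meson order_trans)
qed

text \<open>
  Register 0 holds the input, register 1 collects the output from right to left, and a register
  \<open>r \<ge> 2\<close> represents the number \<^term>\<open>length (s r)\<close>. A computation at level \<open>k\<close> keeps the
  registers below \<open>k\<close>, which hold the bound variables in scope, leaves its result in register \<open>k\<close>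
  and may overwrite everything above. Running times are measured against the registers below \<open>k\<close>
  other than the output, so a bound variable counts as input of the body that it ranges over.
\<close>

definition input_size :: "nat \<Rightarrow> state \<Rightarrow> nat" where
  "input_size k s = (\<Sum>r\<in>{..<k} - {1}. length (s r))"

text \<open>Register 1 is exempt so that values cannot change while output accumulates
  there.\<close>

definition depends_below :: "nat \<Rightarrow> (state \<Rightarrow> 'a) \<Rightarrow> bool" where
  "depends_below k F \<longleftrightarrow> (\<forall>s s'. (\<forall>r<k. r \<noteq> 1 \<longrightarrow> s r = s' r) \<longrightarrow> F s = F s')"

definition preserves :: "nat \<Rightarrow> state \<Rightarrow> state \<Rightarrow> bool" where
  "preserves k s s' \<longleftrightarrow> (\<forall>r<k. s' r = s r)"

definition computes_nat :: "nat \<Rightarrow> (state \<Rightarrow> nat) \<Rightarrow> bool" where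
  "computes_nat k T \<longleftrightarrow> 2 \<le> k \<and> depends_below k T \<and> (\<exists>c p. \<forall>s. T s \<le> poly p (input_size k s) \<and>
    runs c s (poly p (input_size k s)) (\<lambda>s'. preserves k s s' \<and> length (s' k) = T s))"

definition decides :: "nat \<Rightarrow> (state \<Rightarrow> bool) \<Rightarrow> bool" where
  "decides k P \<longleftrightarrow> 2 \<le> k \<and> depends_below k P \<and> (\<exists>c p. \<forall>s.
    runs c s (poly p (input_size k s)) (\<lambda>s'. preserves k s s' \<and> s' k = [P s]))"

definition emits :: "nat \<Rightarrow> (state \<Rightarrow> bool list) \<Rightarrow> bool" where
  "emits k F \<longleftrightarrow> 2 \<le> k \<and> depends_below k F \<and> (\<exists>c p. \<forall>s.
    runs c s (poly p (input_size k s)) (\<lambda>s'. preserves k (s(1 := F s @ s 1)) s'))"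

lemma input_size_Suc: "2 \<le> k \<Longrightarrow> input_size (Suc k) s = input_size k s + length (s k)"
  unfolding input_size_def by (simp add: lessThan_Suc insert_Diff_if)

lemma input_size_cong:
  assumes "preserves k (s(1 := x)) s'"
  shows "input_size k s' = input_size k s"
  unfolding input_size_def
  by (rule sum.cong) (use assms in \<open>auto simp: preserves_def\<close>)

lemma input_size_preserves:
  assumes "preserves k s s'"
  shows "input_size k s' = input_size k s"
  using input_size_cong[of k s "s 1" s'] assms by simp

lemma depends_belowI:
  "(\<And>s s'. (\<And>r. r < k \<Longrightarrow> r \<noteq> 1 \<Longrightarrow> s r = s' r) \<Longrightarrow> F s = F s') \<Longrightarrow> depends_below k F"
  unfolding depends_below_def by blast

lemma depends_belowD:
  "depends_below k F \<Longrightarrow> (\<And>r. r < k \<Longrightarrow> r \<noteq> 1 \<Longrightarrow> s r = s' r) \<Longrightarrow> F s = F s'"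
  unfolding depends_below_def by blast

lemma depends_below_preserves:
  "depends_below k F \<Longrightarrow> preserves k s s' \<Longrightarrow> F s' = F s"
  by (rule depends_belowD) (auto simp: preserves_def)

lemma depends_below_preserves_out:
  "depends_below k F \<Longrightarrow> preserves k (s(1 := x)) s' \<Longrightarrow> F s' = F s"
  by (rule depends_belowD) (auto simp: preserves_def)

text \<open>Filling register \<open>k\<close> with a word of length \<open>x\<close> makes the fixed
  \<open>x\<close> the value of that register, while \<open>Q\<close> itself does not look at the
  register.\<close>

lemma depends_below_bound:
  assumes "depends_below (Suc k) (\<lambda>s. Q s (length (s k)))" and "\<And>s l x. Q (s(k := l)) x = Q s x"
  shows "depends_below k (\<lambda>s. Q s x)"
proof (rule depends_belowI)
  fix s s' :: state assume eq: "\<And>r. r < k \<Longrightarrow> r \<noteq> 1 \<Longrightarrow> s r = s' r"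
  let ?u = "\<lambda>s :: state. s(k := replicate x True)"
  have "Q (?u s) (length (?u s k)) = Q (?u s') (length (?u s' k))"
    using assms(1) by (rule depends_belowD) (auto simp: eq less_Suc_eq)
  then show "Q s x = Q s' x" by (simp add: assms(2))
qed

lemma depends_below_comp2:
  "depends_below k F \<Longrightarrow> depends_below k G \<Longrightarrow> depends_below k (\<lambda>s. h (F s) (G s))"
  unfolding depends_below_def by metis

lemma depends_below_comp:
  "depends_below k F \<Longrightarrow> depends_below k (\<lambda>s. h (F s))"
  unfolding depends_below_def by metis

lemma depends_below_quant:
  "depends_below k T \<Longrightarrow> (\<And>x. depends_below k (\<lambda>s. Q s x)) \<Longrightarrow> depends_below k (\<lambda>s. h (T s) (Q s))"
  unfolding depends_below_def by (metis ext)

lemma computes_natE: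
  assumes "computes_nat k T"
  obtains c p where "2 \<le> k" "depends_below k T" "\<And>s. T s \<le> poly p (input_size k s)"
    "\<And>s. runs c s (poly p (input_size k s)) (\<lambda>s'. preserves k s s' \<and> length (s' k) = T s)"
  using assms unfolding computes_nat_def by blast

lemma decidesE:
  assumes "decides k P"
  obtains c p where "2 \<le> k" "depends_below k P"
    "\<And>s. runs c s (poly p (input_size k s)) (\<lambda>s'. preserves k s s' \<and> s' k = [P s])"
  using assms unfolding decides_def by blast

lemma emitsE:
  assumes "emits k F"
  obtains c p where "2 \<le> k" "depends_below k F"
    "\<And>s. runs c s (poly p (input_size k s)) (\<lambda>s'. preserves k (s(1 := F s @ s 1)) s')"
  using assms unfolding emits_def by blast

lemma computes_natI:
  assumes "2 \<le> k" "depends_below k T" "\<And>s. T s \<le> poly p (input_size k s)"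
    "\<And>s. runs c s (poly p (input_size k s)) (\<lambda>s'. preserves k s s' \<and> length (s' k) = T s)"
  shows "computes_nat k T"
  using assms unfolding computes_nat_def by blast

lemma decidesI:
  assumes "2 \<le> k" "depends_below k P"
    "\<And>s. runs c s (poly p (input_size k s)) (\<lambda>s'. preserves k s s' \<and> s' k = [P s])"
  shows "decides k P"
  using assms unfolding decides_def by blast

lemma emitsI:
  assumes "2 \<le> k" "depends_below k F"
    "\<And>s. runs c s (poly p (input_size k s)) (\<lambda>s'. preserves k (s(1 := F s @ s 1)) s')"
  shows "emits k F"
  using assms unfolding emits_def by blast

section \<open>Arithmetic terms and comparisons\<close>

definition put_bit :: "nat \<Rightarrow> bool \<Rightarrow> prog" where
  "put_bit k b = Seq (Clear k) (Push k b)"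

lemma runs_put_bit: "Q (s(k := [b])) \<Longrightarrow> 2 \<le> B \<Longrightarrow> runs (put_bit k b) s B Q"
  unfolding put_bit_def
  by (intro runs_Seq[where B = 1 and C = 1] runs_Clear runs_Push) auto

lemma computes_nat_var: "2 \<le> k \<Longrightarrow> j < k \<Longrightarrow> j \<noteq> 1 \<Longrightarrow> computes_nat k (\<lambda>s. length (s j))"
proof (rule computes_natI[where c = "Copy k j" and p = "[:1, 1:]"])
  assume j: "j < k" "j \<noteq> 1"
  show "depends_below k (\<lambda>s. length (s j))" using j by (auto simp: depends_below_def)
  fix s :: state
  have "length (s j) \<le> input_size k s"
    unfolding input_size_def using j by (intro member_le_sum) auto
  then show "length (s j) \<le> poly [:1, 1:] (input_size k s)" by simp
  show "runs (Copy k j) s (poly [:1, 1:] (input_size k s))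
      (\<lambda>s'. preserves k s s' \<and> length (s' k) = length (s j))"
    by (rule runs_Copy) (auto simp: preserves_def)
qed

lemma computes_nat_Suc:
  assumes "computes_nat k T"
  shows "computes_nat k (\<lambda>s. Suc (T s))"
  using assms
proof (rule computes_natE)
  fix c p assume k: "2 \<le> k" and dep: "depends_below k T"
    and T: "\<And>s. T s \<le> poly p (input_size k s)"
    and c: "\<And>s. runs c s (poly p (input_size k s)) (\<lambda>s'. preserves k s s' \<and> length (s' k) = T s)"
  show ?thesis
  proof (rule computes_natI[where c = "Seq c (Push k True)" and p = "p + [:1:]", OF k])
    show "depends_below k (\<lambda>s. Suc (T s))" using dep by (rule depends_below_comp)
    fix s
    show "Suc (T s) \<le> poly (p + [:1:]) (input_size k s)" using T[of s] by simp
    show "runs (Seq c (Push k True)) s (poly (p + [:1:]) (input_size k s))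
      (\<lambda>s'. preserves k s s' \<and> length (s' k) = Suc (T s))"
      by (rule runs_Seq[where C = 1], rule runs_mono[OF c order_refl], rule runs_Push)
        (auto simp: preserves_def)
  qed
qed

lemma computes_nat_const: "2 \<le> k \<Longrightarrow> computes_nat k (\<lambda>s. c)"
proof (induction c)
  case 0
  show ?case
  proof (rule computes_natI[where c = "Clear k" and p = "[:1:]", OF 0])
    fix s
    show "runs (Clear k) s (poly [:1:] (input_size k s)) (\<lambda>s'. preserves k s s' \<and> length (s' k) = 0)"
      by (rule runs_Clear) (auto simp: preserves_def)
  qed (simp_all add: depends_below_def)
next
  case (Suc c)
  then show ?case by (intro computes_nat_Suc)
qed

text \<open>The second term is evaluated one level higher, so that the first result survives in
  register \<open>k\<close>. It must not read that register, yet its running time is measured with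
  the first result counted as input.\<close>

lemma computes_nat_pair:
  assumes "computes_nat k T" "computes_nat (Suc k) U" and indep: "\<And>s l. U (s(k := l)) = U s"
  obtains c p where "2 \<le> k" "depends_below k T" "depends_below k U"
    "\<And>s. T s \<le> poly p (input_size k s)" "\<And>s. U s \<le> poly p (input_size k s)"
    "\<And>s. runs c s (poly p (input_size k s))
      (\<lambda>s'. preserves k s s' \<and> length (s' k) = T s \<and> length (s' (Suc k)) = U s)"
proof -
  obtain c p where k: "2 \<le> k" and T: "depends_below k T" "\<And>s. T s \<le> poly p (input_size k s)"
    and c: "\<And>s. runs c s (poly p (input_size k s)) (\<lambda>s'. preserves k s s' \<and> length (s' k) = T s)"
    by (rule computes_natE[OF assms(1)]) (rule that)
  obtain d q where "2 \<le> Suc k" and U: "depends_below (Suc k) U" "\<And>s. U s \<le> poly q (input_size (Suc k) s)"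
    and d: "\<And>s. runs d s (poly q (input_size (Suc k) s))
      (\<lambda>s'. preserves (Suc k) s s' \<and> length (s' (Suc k)) = U s)"
    by (rule computes_natE[OF assms(2)]) (rule that)
  have U': "depends_below k U"
    using depends_below_bound[of k "\<lambda>s x. U s"] U indep by simp
  \<comment> \<open>The input size at level \<open>Suc k\<close> exceeds that at level
    \<open>k\<close> by the length of register \<open>k\<close>, here \<open>T s\<close>; composing
    \<open>q\<close> with the identity plus \<open>p\<close> accounts for this.\<close>
  have bound: "poly q (input_size (Suc k) s') \<le> poly (pcompose q ([:0, 1:] + p)) (input_size k s)"
    if "preserves k s s'" "length (s' k) = T s" for s s'
    using that k T(2)[of s]
    by (simp add: poly_pcompose input_size_Suc input_size_preserves poly_nat_mono)
  show thesis
  proof (rule that[OF k T(1) U', of "p + pcompose q ([:0, 1:] + p)" "Seq c d"])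
    fix s
    let ?B = "poly (pcompose q ([:0, 1:] + p)) (input_size k s)"
    show "T s \<le> poly (p + pcompose q ([:0, 1:] + p)) (input_size k s)"
      using T(2)[of s] by simp
    \<comment> \<open>A state with \<open>T s\<close> bits in register \<open>k\<close> is one to
      which \<open>bound\<close> applies, and \<open>U\<close> takes the same value there.\<close>
    let ?s = "s(k := replicate (T s) True)"
    have "U s = U ?s" by (simp add: indep)
    also have "\<dots> \<le> ?B" using U(2)[of ?s] bound[of s ?s] by (auto simp: preserves_def intro: order_trans)
    finally show "U s \<le> poly (p + pcompose q ([:0, 1:] + p)) (input_size k s)" by simp
    show "runs (Seq c d) s (poly (p + pcompose q ([:0, 1:] + p)) (input_size k s))
      (\<lambda>s'. preserves k s s' \<and> length (s' k) = T s \<and> length (s' (Suc k)) = U s)"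
    proof (rule runs_Seq[where C = ?B], rule runs_mono[OF c order_refl])
      fix s' assume s': "preserves k s s' \<and> length (s' k) = T s"
      then have "U s' = U s" using depends_below_preserves[OF U'] by blast
      with s' show "runs d s' ?B
          (\<lambda>s'. preserves k s s' \<and> length (s' k) = T s \<and> length (s' (Suc k)) = U s)"
        by (intro runs_mono[OF d bound]) (auto simp: preserves_def)
    qed simp
  qed
qed

text \<open>After \<open>T s\<close> simultaneous pops the second register holds
  \<open>U s - T s\<close> bits, truncated at 0 because popping an empty register leaves it empty; a
  bit remains iff \<open>T s < U s\<close>.\<close>

lemma decides_less:
  assumes "computes_nat k T" "computes_nat (Suc k) U" "\<And>s l. U (s(k := l)) = U s"
  shows "decides k (\<lambda>s. T s < U s)"
  using assms
proof (rule computes_nat_pair)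
  fix c p assume k: "2 \<le> k" and dep: "depends_below k T" "depends_below k U"
    and T: "\<And>s. T s \<le> poly p (input_size k s)"
    and c: "\<And>s. runs c s (poly p (input_size k s))
      (\<lambda>s'. preserves k s s' \<and> length (s' k) = T s \<and> length (s' (Suc k)) = U s)"
  let ?l = "Loop (Nonempty k) (Seq (Pop k) (Pop (Suc k)))"
  let ?c = "Seq c (Seq ?l (Cond (Nonempty (Suc k)) (put_bit k True) (put_bit k False)))"
  show ?thesis
  proof (rule decidesI[where c = ?c and p = "[:4:] * p + [:4:]", OF k])
    show "depends_below k (\<lambda>s. T s < U s)" using dep by (rule depends_below_comp2)
    fix s
    define J where "J m s' \<longleftrightarrow> preserves k s s' \<and> length (s' k) = m \<and> m \<le> T s \<and>
      length (s' (Suc k)) = U s - (T s - m)" for m and s' :: state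
    show "runs ?c s (poly ([:4:] * p + [:4:]) (input_size k s))
      (\<lambda>s'. preserves k s s' \<and> s' k = [T s < U s])"
    proof (rule runs_Seq[where C = "3 * T s + 1 + 3"], rule runs_mono[OF c order_refl],
        rule runs_Seq[where C = 3 and B = "3 * T s + 1"], rule runs_Loop[where I = J and m = "T s" and B = 2])
      fix m s' assume J: "J (Suc m) s'"
      show "runs (Seq (Pop k) (Pop (Suc k))) s' 2 (\<lambda>s'. \<exists>m'\<le>m. J m' s')"
        using J
        by (intro runs_Seq[where B = 1 and C = 1] runs_Pop exI[of _ m])
          (auto simp: J_def preserves_def)
    next
      fix s' assume J: "J 0 s'"
      then have "s' (Suc k) = [] \<longleftrightarrow> U s \<le> T s"
        unfolding J_def by (metis diff_is_0_eq diff_zero length_0_conv)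
      with J show "runs (Cond (Nonempty (Suc k)) (put_bit k True) (put_bit k False)) s' 3
          (\<lambda>s'. preserves k s s' \<and> s' k = [T s < U s])"
        by (intro runs_Cond[where B = 2] runs_put_bit) (auto simp: J_def preserves_def)
    qed (use T[of s] in \<open>auto simp: J_def\<close>)
  qed
qed

lemma computes_nat_add:
  assumes "computes_nat k T" "computes_nat (Suc k) U" "\<And>s l. U (s(k := l)) = U s"
  shows "computes_nat k (\<lambda>s. T s + U s)"
  using assms
proof (rule computes_nat_pair)
  fix c p assume k: "2 \<le> k" and dep: "depends_below k T" "depends_below k U"
    and T: "\<And>s. T s \<le> poly p (input_size k s)" and U: "\<And>s. U s \<le> poly p (input_size k s)"
    and c: "\<And>s. runs c s (poly p (input_size k s))
      (\<lambda>s'. preserves k s s' \<and> length (s' k) = T s \<and> length (s' (Suc k)) = U s)"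
  let ?c = "Seq c (Loop (Nonempty (Suc k)) (Seq (Pop (Suc k)) (Push k True)))"
  show ?thesis
  proof (rule computes_natI[where c = ?c and p = "[:4:] * p + [:1:]", OF k])
    show "depends_below k (\<lambda>s. T s + U s)" using dep by (rule depends_below_comp2)
    fix s
    define J where "J m s' \<longleftrightarrow> preserves k s s' \<and> length (s' (Suc k)) = m \<and>
      length (s' k) + m = T s + U s" for m and s' :: state
    show "T s + U s \<le> poly ([:4:] * p + [:1:]) (input_size k s)" using T[of s] U[of s] by simp
    show "runs ?c s (poly ([:4:] * p + [:1:]) (input_size k s))
      (\<lambda>s'. preserves k s s' \<and> length (s' k) = T s + U s)"
    proof (rule runs_Seq[where C = "3 * U s + 1"], rule runs_mono[OF c order_refl],
        rule runs_Loop[where I = J and m = "U s" and B = 2])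
      fix m s' assume J: "J (Suc m) s'"
      show "runs (Seq (Pop (Suc k)) (Push k True)) s' 2 (\<lambda>s'. \<exists>m'\<le>m. J m' s')"
        using J
        by (intro runs_Seq[where B = 1 and C = 1] runs_Pop runs_Push exI[of _ m])
          (auto simp: J_def preserves_def)
    qed (use U[of s] in \<open>auto simp: J_def\<close>)
  qed
qed

lemma computes_nat_diff:
  assumes "computes_nat k T" "computes_nat (Suc k) U" "\<And>s l. U (s(k := l)) = U s"
  shows "computes_nat k (\<lambda>s. T s - U s)"
  using assms
proof (rule computes_nat_pair)
  fix c p assume k: "2 \<le> k" and dep: "depends_below k T" "depends_below k U"
    and T: "\<And>s. T s \<le> poly p (input_size k s)" and U: "\<And>s. U s \<le> poly p (input_size k s)"
    and c: "\<And>s. runs c s (poly p (input_size k s))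
      (\<lambda>s'. preserves k s s' \<and> length (s' k) = T s \<and> length (s' (Suc k)) = U s)"
  let ?c = "Seq c (Loop (Nonempty (Suc k)) (Seq (Pop (Suc k)) (Pop k)))"
  show ?thesis
  proof (rule computes_natI[where c = ?c and p = "[:4:] * p + [:1:]", OF k])
    show "depends_below k (\<lambda>s. T s - U s)" using dep by (rule depends_below_comp2)
    fix s
    define J where "J m s' \<longleftrightarrow> preserves k s s' \<and> length (s' (Suc k)) = m \<and> m \<le> U s \<and>
      length (s' k) = T s - (U s - m)" for m and s' :: state
    show "T s - U s \<le> poly ([:4:] * p + [:1:]) (input_size k s)" using T[of s] U[of s] by simp
    show "runs ?c s (poly ([:4:] * p + [:1:]) (input_size k s))
      (\<lambda>s'. preserves k s s' \<and> length (s' k) = T s - U s)"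
    proof (rule runs_Seq[where C = "3 * U s + 1"], rule runs_mono[OF c order_refl],
        rule runs_Loop[where I = J and m = "U s" and B = 2])
      fix m s' assume J: "J (Suc m) s'"
      show "runs (Seq (Pop (Suc k)) (Pop k)) s' 2 (\<lambda>s'. \<exists>m'\<le>m. J m' s')"
        using J
        by (intro runs_Seq[where B = 1 and C = 1] runs_Pop exI[of _ m])
          (auto simp: J_def preserves_def)
    qed (use U[of s] in \<open>auto simp: J_def\<close>)
  qed
qed

lemma computes_nat_mult:
  assumes "computes_nat k T" "computes_nat (Suc k) U" "\<And>s l. U (s(k := l)) = U s"
  shows "computes_nat k (\<lambda>s. T s * U s)"
  using assms
proof (rule computes_nat_pair)
  fix c p assume k: "2 \<le> k" and dep: "depends_below k T" "depends_below k U"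
    and T: "\<And>s. T s \<le> poly p (input_size k s)" and U: "\<And>s. U s \<le> poly p (input_size k s)"
    and c: "\<And>s. runs c s (poly p (input_size k s))
      (\<lambda>s'. preserves k s s' \<and> length (s' k) = T s \<and> length (s' (Suc k)) = U s)"
  let ?a = "Suc (Suc k)" and ?i = "Suc (Suc (Suc k))"
  let ?inner = "Loop (Nonempty ?i) (Seq (Pop ?i) (Push ?a True))"
  let ?outer = "Loop (Nonempty k) (Seq (Pop k) (Seq (Copy ?i (Suc k)) ?inner))"
  let ?c = "Seq c (Seq (Clear ?a) (Seq ?outer (Copy k ?a)))"
  show ?thesis
  proof (rule computes_natI[where c = ?c and p = "[:7:] * p * (p + [:1:]) + [:3:]", OF k])
    show "depends_below k (\<lambda>s. T s * U s)" using dep by (rule depends_below_comp2)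
    fix s
    let ?x = "input_size k s"
    \<comment> \<open>The accumulator together with what the remaining \<open>m\<close> rounds will
      add makes up the product.\<close>
    define J where "J m s' \<longleftrightarrow> preserves k s s' \<and> length (s' k) = m \<and> length (s' (Suc k)) = U s \<and>
      length (s' ?a) + m * U s = T s * U s" for m and s' :: state
    have TU: "T s * U s \<le> poly p ?x * poly p ?x" using T U by (rule mult_mono) auto
    then show "T s * U s \<le> poly ([:7:] * p * (p + [:1:]) + [:3:]) ?x"
      by (simp add: algebra_simps)
    show "runs ?c s (poly ([:7:] * p * (p + [:1:]) + [:3:]) ?x)
      (\<lambda>s'. preserves k s s' \<and> length (s' k) = T s * U s)"
    \<comment> \<open>A round costs at most \<open>3 * U s + 4\<close> steps: two for the pop and
      the copy, \<open>3 * U s + 1\<close> for the inner loop, and one for the test.\<close>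
    proof (rule runs_Seq[where C = "1 + (T s * (3 * U s + 4) + 1 + 1)"], rule runs_mono[OF c order_refl],
        rule runs_Seq[where B = 1 and C = "T s * (3 * U s + 4) + 1 + 1"], rule runs_Clear,
        rule runs_Seq[where C = 1 and B = "T s * (3 * U s + 4) + 1"],
        rule runs_Loop[where I = J and m = "T s" and B = "3 * U s + 3"])
      fix m s' assume J: "J (Suc m) s'"
      define I where "I i s'' \<longleftrightarrow> preserves k s s'' \<and> length (s'' k) = m \<and>
        length (s'' (Suc k)) = U s \<and> length (s'' ?i) = i \<and>
        length (s'' ?a) + i + m * U s = T s * U s" for i and s'' :: state
      show "runs (Seq (Pop k) (Seq (Copy ?i (Suc k)) ?inner)) s' (3 * U s + 3) (\<lambda>s'. \<exists>m'\<le>m. J m' s')"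
      proof (rule runs_Seq[where B = 1 and C = "1 + (3 * U s + 1)"], rule runs_Pop,
          rule runs_Seq[where B = 1 and C = "3 * U s + 1"], rule runs_Copy,
          rule runs_Loop[where I = I and m = "U s" and B = 2])
        fix i s'' assume I: "I (Suc i) s''"
        then show "runs (Seq (Pop ?i) (Push ?a True)) s'' 2 (\<lambda>s'. \<exists>m'\<le>i. I m' s')"
          by (intro runs_Seq[where B = 1 and C = 1] runs_Pop runs_Push exI[of _ i])
            (auto simp: I_def preserves_def)
      next
        fix s'' assume "I 0 s''"
        then show "\<exists>m'\<le>m. J m' s''"
          by (intro exI[of _ m]) (auto simp: I_def J_def)
      qed (use J in \<open>auto simp: I_def J_def preserves_def\<close>)
    next
      fix s' assume "J 0 s'"
      then show "runs (Copy k ?a) s' 1 (\<lambda>s'. preserves k s s' \<and> length (s' k) = T s * U s)"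
        by (intro runs_Copy) (auto simp: J_def preserves_def)
    next
      show "poly p ?x + (1 + (T s * (3 * U s + 4) + 1 + 1)) \<le> poly ([:7:] * p * (p + [:1:]) + [:3:]) ?x"
        using TU T[of s] by (simp add: algebra_simps)
    qed (auto simp: J_def preserves_def)
  qed
qed

section \<open>Connectives, bounded quantifiers and input bits\<close>

lemma decides_not:
  assumes "decides k P"
  shows "decides k (\<lambda>s. \<not> P s)"
  using assms
proof (rule decidesE)
  fix c p assume k: "2 \<le> k" and P: "depends_below k P"
    and c: "\<And>s. runs c s (poly p (input_size k s)) (\<lambda>s'. preserves k s s' \<and> s' k = [P s])"
  let ?c = "Seq c (Cond (Top k) (put_bit k False) (put_bit k True))"
  show ?thesis
  proof (rule decidesI[where c = ?c and p = "p + [:3:]", OF k])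
    show "depends_below k (\<lambda>s. \<not> P s)" using P by (rule depends_below_comp)
    fix s
    show "runs ?c s (poly (p + [:3:]) (input_size k s)) (\<lambda>s'. preserves k s s' \<and> s' k = [\<not> P s])"
      by (rule runs_Seq[where C = 3], rule runs_mono[OF c order_refl],
          intro runs_Cond[where B = 2] runs_put_bit) (auto simp: preserves_def)
  qed
qed

lemma decides_conj:
  assumes "decides k P" "decides k Q"
  shows "decides k (\<lambda>s. P s \<and> Q s)"
  using assms(1)
proof (rule decidesE)
  fix c p assume k: "2 \<le> k" and P: "depends_below k P"
    and c: "\<And>s. runs c s (poly p (input_size k s)) (\<lambda>s'. preserves k s s' \<and> s' k = [P s])"
  from assms(2) show ?thesis
  proof (rule decidesE)
    fix d q assume Q: "depends_below k Q"
      and d: "\<And>s. runs d s (poly q (input_size k s)) (\<lambda>s'. preserves k s s' \<and> s' k = [Q s])"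
    let ?c = "Seq c (Cond (Top k) d Skip)"
    show ?thesis
    proof (rule decidesI[where c = ?c and p = "p + q + [:2:]", OF k])
      show "depends_below k (\<lambda>s. P s \<and> Q s)" using P Q by (rule depends_below_comp2)
      fix s
      let ?x = "input_size k s"
      show "runs ?c s (poly (p + q + [:2:]) ?x) (\<lambda>s'. preserves k s s' \<and> s' k = [P s \<and> Q s])"
      proof (rule runs_Seq[where C = "poly q ?x + 2"], rule runs_mono[OF c order_refl])
        fix s' assume s': "preserves k s s' \<and> s' k = [P s]"
        then have "input_size k s' = ?x" by (simp add: input_size_preserves)
        show "runs (Cond (Top k) d Skip) s' (poly q ?x + 2)
          (\<lambda>s'. preserves k s s' \<and> s' k = [P s \<and> Q s])"
        proof (rule runs_Cond[where B = "poly q ?x + 1"])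
          assume "test_holds (Top k) s'"
          with s' \<open>input_size k s' = ?x\<close> depends_below_preserves[OF Q] show "runs d s' (poly q ?x + 1)
            (\<lambda>s'. preserves k s s' \<and> s' k = [P s \<and> Q s])"
            by (intro runs_mono[OF d]) (auto simp: preserves_def)
        next
          assume "\<not> test_holds (Top k) s'"
          with s' show "runs Skip s' (poly q ?x + 1) (\<lambda>s'. preserves k s s' \<and> s' k = [P s \<and> Q s])"
            by (intro runs_Skip) auto
        qed simp
      qed simp
    qed
  qed
qed

lemma decides_disj:
  assumes "decides k P" "decides k Q"
  shows "decides k (\<lambda>s. P s \<or> Q s)"
  using decides_not[OF decides_conj[OF decides_not[OF assms(1)] decides_not[OF assms(2)]]] by simp

lemma decides_imp:
  assumes "decides k P" "decides k Q"
  shows "decides k (\<lambda>s. P s \<longrightarrow> Q s)"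
  using decides_disj[OF decides_not[OF assms(1)] assms(2)] by simp

lemma decides_iff:
  assumes "decides k P" "decides k Q"
  shows "decides k (\<lambda>s. P s \<longleftrightarrow> Q s)"
proof -
  have "(\<lambda>s. P s \<longleftrightarrow> Q s) = (\<lambda>s. (P s \<longrightarrow> Q s) \<and> (Q s \<longrightarrow> P s))" by auto
  then show ?thesis using decides_conj[OF decides_imp[OF assms] decides_imp[OF assms(2,1)]] by (simp only:)
qed

lemma decides_if:
  assumes "decides k P" "decides k Q" "decides k R"
  shows "decides k (\<lambda>s. if P s then Q s else R s)"
  using decides_conj[OF decides_imp[OF assms(1,2)] decides_imp[OF decides_not[OF assms(1)] assms(3)]]
  by (simp add: if_bool_eq_conj)

text \<open>Register \<open>k\<close> is both the loop counter and the bound variable, tried from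
  \<open>T s - 1\<close> downwards. Every round overwrites the answer in register
  \<open>Suc k\<close>, so a witness must end the loop at once, which is done by clearing the
  counter.\<close>

lemma decides_ex:
  assumes "computes_nat k T" "decides (Suc k) (\<lambda>s. Q s (length (s k)))" and indep: "\<And>s l x. Q (s(k := l)) x = Q s x"
  shows "decides k (\<lambda>s. \<exists>x<T s. Q s x)"
  using assms(1)
proof (rule computes_natE)
  fix c p assume k: "2 \<le> k" and depT: "depends_below k T"
    and T: "\<And>s. T s \<le> poly p (input_size k s)"
    and c: "\<And>s. runs c s (poly p (input_size k s)) (\<lambda>s'. preserves k s s' \<and> length (s' k) = T s)"
  from assms(2) show ?thesis
  proof (rule decidesE)
    fix d q assume dep: "depends_below (Suc k) (\<lambda>s. Q s (length (s k)))"
      and d: "\<And>s. runs d s (poly q (input_size (Suc k) s))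
        (\<lambda>s'. preserves (Suc k) s s' \<and> s' (Suc k) = [Q s (length (s k))])"
    have depQ: "depends_below k (\<lambda>s. Q s x)" for x
      using dep indep by (rule depends_below_bound)
    let ?b = "Seq (Pop k) (Seq d (Cond (Top (Suc k)) (Clear k) Skip))"
    let ?c = "Seq c (Seq (put_bit (Suc k) False) (Seq (Loop (Nonempty k) ?b) (Copy k (Suc k))))"
    let ?q = "pcompose q ([:0, 1:] + p)"
    show ?thesis
    proof (rule decidesI[where c = ?c and p = "p + p * (?q + [:4:]) + [:4:]", OF k])
      show "depends_below k (\<lambda>s. \<exists>x<T s. Q s x)"
        using depT depQ by (rule depends_below_quant)
      fix s
      let ?x = "input_size k s"
      let ?B = "poly ?q ?x"
      \<comment> \<open>A positive counter certifies that there is no witness from \<open>m\<close>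
        on; at counter 0 only the answer bit is constrained, which also covers the early
        exit.\<close>
      define J where "J m s' \<longleftrightarrow> preserves k s s' \<and> length (s' k) = m \<and> m \<le> T s \<and>
        s' (Suc k) = [\<exists>x<T s. m \<le> x \<and> Q s x] \<and> (0 < m \<longrightarrow> \<not> (\<exists>x<T s. m \<le> x \<and> Q s x))"
        for m and s' :: state
      show "runs ?c s (poly (p + p * (?q + [:4:]) + [:4:]) ?x)
        (\<lambda>s'. preserves k s s' \<and> s' k = [\<exists>x<T s. Q s x])"
      proof (rule runs_Seq[where C = "2 + (T s * (?B + 3 + 1) + 1 + 1)"], rule runs_mono[OF c order_refl],
          rule runs_Seq[where B = 2 and C = "T s * (?B + 3 + 1) + 1 + 1"], rule runs_put_bit,
          rule runs_Seq[where C = 1 and B = "T s * (?B + 3 + 1) + 1"],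
          rule runs_Loop[where I = J and m = "T s" and B = "?B + 3"])
        fix m s' assume J: "J (Suc m) s'"
        define u where "u = s'(k := tl (s' k))"
        have u: "preserves k s u" "length (u k) = m" using J by (auto simp: J_def u_def preserves_def)
        have "Q u x = Q s x" for x using depends_below_preserves[OF depQ u(1)] .
        moreover have "poly q (input_size (Suc k) u) \<le> ?B"
          using u T[of s] J k
          by (simp add: input_size_Suc input_size_preserves poly_pcompose poly_nat_mono J_def)
        ultimately have d': "runs d u ?B (\<lambda>s'. preserves (Suc k) u s' \<and> s' (Suc k) = [Q s m])"
          by (intro runs_mono[OF d]) (simp_all add: u)
        show "runs ?b s' (?B + 3) (\<lambda>s'. \<exists>m'\<le>m. J m' s')"
        proof (rule runs_Seq[where B = 1 and C = "?B + 2"], rule runs_Pop, fold u_def,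
            rule runs_Seq[where C = 2], rule runs_mono[OF d' order_refl])
          fix s'' assume s'': "preserves (Suc k) u s'' \<and> s'' (Suc k) = [Q s m]"
          show "runs (Cond (Top (Suc k)) (Clear k) Skip) s'' 2 (\<lambda>s'. \<exists>m'\<le>m. J m' s')"
          proof (rule runs_Cond[where B = 1])
            assume "test_holds (Top (Suc k)) s''"
            with s'' J have "\<exists>x<T s. Q s x" by (intro exI[of _ m]) (auto simp: J_def)
            then have "J 0 (s''(k := []))"
              using s'' u \<open>test_holds (Top (Suc k)) s''\<close> by (simp add: J_def preserves_def)
            then show "runs (Clear k) s'' 1 (\<lambda>s'. \<exists>m'\<le>m. J m' s')"
              by (intro runs_Clear) auto
          next
            assume "\<not> test_holds (Top (Suc k)) s''"
            with s'' have Q: "\<not> Q s m" by simp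
            have "\<not> (\<exists>x<T s. m \<le> x \<and> Q s x)"
            proof
              assume "\<exists>x<T s. m \<le> x \<and> Q s x"
              then obtain x where x: "x < T s" "m \<le> x" "Q s x" by blast
              with Q have "Suc m \<le> x" by (cases "x = m") auto
              with x J show False by (auto simp: J_def)
            qed
            then have "J m s''"
              using s'' u J Q unfolding J_def preserves_def by auto
            then show "runs Skip s'' 1 (\<lambda>s'. \<exists>m'\<le>m. J m' s')"
              by (intro runs_Skip) auto
          qed simp
        qed auto
      next
        fix s' assume "J 0 s'"
        then show "runs (Copy k (Suc k)) s' 1 (\<lambda>s'. preserves k s s' \<and> s' k = [\<exists>x<T s. Q s x])"
          by (intro runs_Copy) (auto simp: J_def preserves_def)
      next
        have "T s * (?B + 3 + 1) \<le> poly p ?x * (?B + 3 + 1)"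
          using T by (rule mult_right_mono) simp
        then show "poly p ?x + (2 + (T s * (?B + 3 + 1) + 1 + 1))
            \<le> poly (p + p * (?q + [:4:]) + [:4:]) ?x"
          by (simp add: algebra_simps)
      qed (auto simp: J_def preserves_def)
    qed
  qed
qed

lemma decides_all:
  assumes "computes_nat k T" "decides (Suc k) (\<lambda>s. Q s (length (s k)))" "\<And>s l x. Q (s(k := l)) x = Q s x"
  shows "decides k (\<lambda>s. \<forall>x<T s. Q s x)"
proof -
  have "decides k (\<lambda>s. \<exists>x<T s. \<not> Q s x)"
    using assms(1) decides_not[OF assms(2)] by (rule decides_ex) (simp only: assms(3))
  from decides_not[OF this] show ?thesis by simp
qed

lemma decides_le:
  assumes "computes_nat k T" "computes_nat (Suc k) U" "\<And>s l. U (s(k := l)) = U s"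
  shows "decides k (\<lambda>s. U s \<le> T s)"
  using decides_not[OF decides_less[OF assms]] by (simp add: not_less)

text \<open>Positions beyond the end read as \<open>False\<close>, just as \<open>Top\<close> fails
  on an empty register.\<close>

definition bit_at :: "bool list \<Rightarrow> nat \<Rightarrow> bool" where
  "bit_at w i \<longleftrightarrow> i < length w \<and> w ! i"

text \<open>Popping a copy of the input \<open>T s\<close> times brings the bit at position
  \<open>T s\<close> to the top, or empties the copy if there is none; the input itself stays
  intact.\<close>

lemma decides_bit_at:
  assumes "computes_nat k T"
  shows "decides k (\<lambda>s. bit_at (s 0) (T s))"
  using assms
proof (rule computes_natE)
  fix c p assume k: "2 \<le> k" and dep: "depends_below k T"
    and T: "\<And>s. T s \<le> poly p (input_size k s)"
    and c: "\<And>s. runs c s (poly p (input_size k s)) (\<lambda>s'. preserves k s s' \<and> length (s' k) = T s)"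
  let ?l = "Loop (Nonempty k) (Seq (Pop k) (Pop (Suc k)))"
  let ?c = "Seq c (Seq (Copy (Suc k) 0) (Seq ?l (Cond (Top (Suc k)) (put_bit k True) (put_bit k False))))"
  show ?thesis
  proof (rule decidesI[where c = ?c and p = "[:4:] * p + [:5:]", OF k])
    have "depends_below k (\<lambda>s. s 0)" using k by (auto simp: depends_below_def)
    then show "depends_below k (\<lambda>s. bit_at (s 0) (T s))" using dep by (rule depends_below_comp2)
    fix s
    define J where "J m s' \<longleftrightarrow> preserves k s s' \<and> length (s' k) = m \<and> m \<le> T s \<and>
      s' (Suc k) = drop (T s - m) (s 0)" for m and s' :: state
    show "runs ?c s (poly ([:4:] * p + [:5:]) (input_size k s))
      (\<lambda>s'. preserves k s s' \<and> s' k = [bit_at (s 0) (T s)])"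
    proof (rule runs_Seq[where C = "1 + (3 * T s + 1 + 3)"], rule runs_mono[OF c order_refl],
        rule runs_Seq[where B = 1 and C = "3 * T s + 1 + 3"], rule runs_Copy,
        rule runs_Seq[where C = 3 and B = "3 * T s + 1"], rule runs_Loop[where I = J and m = "T s" and B = 2])
      fix m s' assume J: "J (Suc m) s'"
      then have "tl (s' (Suc k)) = drop (T s - m) (s 0)"
        by (simp add: J_def tl_drop drop_Suc[symmetric] Suc_diff_Suc Suc_le_eq del: drop_Suc)
      with J show "runs (Seq (Pop k) (Pop (Suc k))) s' 2 (\<lambda>s'. \<exists>m'\<le>m. J m' s')"
        by (intro runs_Seq[where B = 1 and C = 1] runs_Pop exI[of _ m])
          (auto simp: J_def preserves_def)
    next
      fix s' assume J: "J 0 s'"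
      have "drop n w \<noteq> [] \<and> hd (drop n w) \<longleftrightarrow> bit_at w n" for n and w :: "bool list"
        by (auto simp: bit_at_def hd_drop_conv_nth)
      with J have "test_holds (Top (Suc k)) s' \<longleftrightarrow> bit_at (s 0) (T s)"
        by (simp add: J_def)
      with J show "runs (Cond (Top (Suc k)) (put_bit k True) (put_bit k False)) s' 3
          (\<lambda>s'. preserves k s s' \<and> s' k = [bit_at (s 0) (T s)])"
        by (intro runs_Cond[where B = 2] runs_put_bit) (auto simp: J_def preserves_def)
    qed (use T[of s] k in \<open>auto simp: J_def preserves_def\<close>)
  qed
qed

lemma decides_eq:
  assumes "computes_nat k T" "computes_nat (Suc k) U" "computes_nat k U" "computes_nat (Suc k) T"
    "\<And>s l. U (s(k := l)) = U s" "\<And>s l. T (s(k := l)) = T s"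
  shows "decides k (\<lambda>s. T s = U s)"
  using decides_conj[OF decides_le[OF assms(1,2,5)] decides_le[OF assms(3,4,6)]] by (simp add: eq_iff conj_commute)

section \<open>Output words\<close>

lemma emits_Nil: "2 \<le> k \<Longrightarrow> emits k (\<lambda>s. [])"
proof (rule emitsI[where c = Skip and p = "[:1:]"])
  fix s
  show "runs Skip s (poly [:1:] (input_size k s)) (preserves k (s(1 := [] @ s 1)))"
    by (rule runs_Skip) (auto simp: preserves_def)
qed (simp_all add: depends_below_def)

lemma emits_bit:
  assumes "decides k P"
  shows "emits k (\<lambda>s. [P s])"
  using assms
proof (rule decidesE)
  fix c p assume k: "2 \<le> k" and P: "depends_below k P"
    and c: "\<And>s. runs c s (poly p (input_size k s)) (\<lambda>s'. preserves k s s' \<and> s' k = [P s])"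
  let ?c = "Seq c (Cond (Top k) (Push 1 True) (Push 1 False))"
  show ?thesis
  proof (rule emitsI[where c = ?c and p = "p + [:2:]", OF k])
    show "depends_below k (\<lambda>s. [P s])" using P by (rule depends_below_comp)
    fix s
    show "runs ?c s (poly (p + [:2:]) (input_size k s)) (preserves k (s(1 := [P s] @ s 1)))"
    proof (rule runs_Seq[where C = 2], rule runs_mono[OF c order_refl])
      fix s' assume "preserves k s s' \<and> s' k = [P s]"
      with k show "runs (Cond (Top k) (Push 1 True) (Push 1 False)) s' 2
          (preserves k (s(1 := [P s] @ s 1)))"
        by (intro runs_Cond[where B = 1] runs_Push) (auto simp: preserves_def)
    qed simp
  qed
qed

text \<open>Output is pushed onto register 1 and thus produced from right to left, so the program
  for \<open>G\<close> runs first. \<open>F\<close> keeps its value because it does not depend on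
  register 1.\<close>

lemma emits_append:
  assumes "emits k F" "emits k G"
  shows "emits k (\<lambda>s. F s @ G s)"
  using assms(1)
proof (rule emitsE)
  fix c p assume k: "2 \<le> k" and F: "depends_below k F"
    and c: "\<And>s. runs c s (poly p (input_size k s)) (preserves k (s(1 := F s @ s 1)))"
  from assms(2) show ?thesis
  proof (rule emitsE)
    fix d q assume G: "depends_below k G"
      and d: "\<And>s. runs d s (poly q (input_size k s)) (preserves k (s(1 := G s @ s 1)))"
    show ?thesis
    proof (rule emitsI[where c = "Seq d c" and p = "q + p", OF k])
      show "depends_below k (\<lambda>s. F s @ G s)" using F G by (rule depends_below_comp2)
      fix s
      show "runs (Seq d c) s (poly (q + p) (input_size k s)) (preserves k (s(1 := (F s @ G s) @ s 1)))"
      proof (rule runs_Seq[where C = "poly p (input_size k s)"], rule runs_mono[OF d order_refl])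
        fix s' assume s': "preserves k (s(1 := G s @ s 1)) s'"
        then have "s' 1 = G s @ s 1" using k by (auto simp: preserves_def)
        with s' show "runs c s' (poly p (input_size k s)) (preserves k (s(1 := (F s @ G s) @ s 1)))"
          using depends_below_preserves_out[OF F s'] input_size_cong[OF s']
          by (intro runs_mono[OF c]) (auto simp: preserves_def)
      qed simp
    qed
  qed
qed

lemma emits_if:
  assumes "decides k P" "emits k F" "emits k G"
  shows "emits k (\<lambda>s. if P s then F s else G s)"
  using assms(1)
proof (rule decidesE)
  fix b r assume k: "2 \<le> k" and P: "depends_below k P"
    and b: "\<And>s. runs b s (poly r (input_size k s)) (\<lambda>s'. preserves k s s' \<and> s' k = [P s])"
  from assms(2) show ?thesis
  proof (rule emitsE)
    fix c p assume F: "depends_below k F"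
      and c: "\<And>s. runs c s (poly p (input_size k s)) (preserves k (s(1 := F s @ s 1)))"
    from assms(3) show ?thesis
    proof (rule emitsE)
      fix d q assume G: "depends_below k G"
        and d: "\<And>s. runs d s (poly q (input_size k s)) (preserves k (s(1 := G s @ s 1)))"
      let ?c = "Seq b (Cond (Top k) c d)"
      show ?thesis
      proof (rule emitsI[where c = ?c and p = "r + p + q + [:1:]", OF k])
        show "depends_below k (\<lambda>s. if P s then F s else G s)"
          using P F G unfolding depends_below_def by metis
        fix s
        let ?x = "input_size k s"
        show "runs ?c s (poly (r + p + q + [:1:]) ?x)
          (preserves k (s(1 := (if P s then F s else G s) @ s 1)))"
        proof (rule runs_Seq[where C = "poly p ?x + poly q ?x + 1"], rule runs_mono[OF b order_refl])
          fix s' assume s': "preserves k s s' \<and> s' k = [P s]"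
          then have "s' 1 = s 1" "F s' = F s" "G s' = G s" "input_size k s' = ?x"
            using k depends_below_preserves[OF F] depends_below_preserves[OF G]
            by (auto simp: preserves_def input_size_preserves)
          with s' k show "runs (Cond (Top k) c d) s' (poly p ?x + poly q ?x + 1)
            (preserves k (s(1 := (if P s then F s else G s) @ s 1)))"
            by (intro runs_Cond[where B = "poly p ?x + poly q ?x"] runs_mono[OF c] runs_mono[OF d])
              (auto simp: preserves_def)
        qed simp
      qed
    qed
  qed
qed

text \<open>The counter runs downwards, so the last block is emitted first, which is the order that
  prepending requires.\<close>

lemma emits_concat_map:
  assumes "computes_nat k T" "emits (Suc k) (\<lambda>s. F s (length (s k)))"
    and indep: "\<And>s l x. F (s(k := l)) x = F s x"
  shows "emits k (\<lambda>s. concat (map (F s) [0..<T s]))"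
  using assms(1)
proof (rule computes_natE)
  fix c p assume k: "2 \<le> k" and depT: "depends_below k T"
    and T: "\<And>s. T s \<le> poly p (input_size k s)"
    and c: "\<And>s. runs c s (poly p (input_size k s)) (\<lambda>s'. preserves k s s' \<and> length (s' k) = T s)"
  from assms(2) show ?thesis
  proof (rule emitsE)
    fix d q assume dep: "depends_below (Suc k) (\<lambda>s. F s (length (s k)))"
      and d: "\<And>s. runs d s (poly q (input_size (Suc k) s))
        (preserves (Suc k) (s(1 := F s (length (s k)) @ s 1)))"
    have depF: "depends_below k (\<lambda>s. F s x)" for x
      using dep indep by (rule depends_below_bound)
    let ?b = "Seq (Pop k) d"
    let ?c = "Seq c (Loop (Nonempty k) ?b)"
    let ?q = "pcompose q ([:0, 1:] + p)"
    show ?thesis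
    proof (rule emitsI[where c = ?c and p = "p + p * (?q + [:2:]) + [:1:]", OF k])
      show "depends_below k (\<lambda>s. concat (map (F s) [0..<T s]))"
        using depT depF by (rule depends_below_quant)
      fix s
      let ?x = "input_size k s"
      let ?B = "poly ?q ?x"
      define J where "J m s' \<longleftrightarrow> length (s' k) = m \<and> m \<le> T s \<and>
        preserves k (s(1 := concat (map (F s) [m..<T s]) @ s 1)) s'"
        for m and s' :: state
      show "runs ?c s (poly (p + p * (?q + [:2:]) + [:1:]) ?x)
        (preserves k (s(1 := concat (map (F s) [0..<T s]) @ s 1)))"
      proof (rule runs_Seq[where C = "T s * (?B + 1 + 1) + 1"], rule runs_mono[OF c order_refl],
          rule runs_Loop[where I = J and m = "T s" and B = "?B + 1"])
        fix m s' assume J: "J (Suc m) s'"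
        define u where "u = s'(k := tl (s' k))"
        let ?o = "concat (map (F s) [Suc m..<T s]) @ s 1"
        have u: "preserves k (s(1 := ?o)) u" "length (u k) = m" "m < T s" "u 1 = ?o"
          using J k by (auto simp: J_def u_def preserves_def)
        have F: "F u x = F s x" for x using depends_below_preserves_out[OF depF u(1)] .
        have bound: "poly q (input_size (Suc k) u) \<le> ?B"
          using u T[of s] k input_size_cong[OF u(1)]
          by (simp add: input_size_Suc poly_pcompose poly_nat_mono)
        show "runs ?b s' (?B + 1) (\<lambda>s'. \<exists>m'\<le>m. J m' s')"
        proof (rule runs_Seq[where B = 1 and C = ?B], rule runs_Pop, fold u_def,
            rule runs_mono[OF d bound], intro exI[of _ m] conjI order_refl)
          fix s'' assume "preserves (Suc k) (u(1 := F u (length (u k)) @ u 1)) s''"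
          with u k show "J m s''"
            by (auto simp: J_def preserves_def F upt_conv_Cons)
        qed auto
      next
        have "T s * (?B + 2) \<le> poly p ?x * (?B + 2)"
          using T by (rule mult_right_mono) simp
        then show "poly p ?x + (T s * (?B + 1 + 1) + 1) \<le> poly (p + p * (?q + [:2:]) + [:1:]) ?x"
          by (simp add: algebra_simps)
      qed (auto simp: J_def preserves_def)
    qed
  qed
qed

lemma emits_map:
  assumes "computes_nat k T" "decides (Suc k) (\<lambda>s. P s (length (s k)))" "\<And>s l x. P (s(k := l)) x = P s x"
  shows "emits k (\<lambda>s. map (P s) [0..<T s])"
proof -
  have "emits k (\<lambda>s. concat (map (\<lambda>x. [P s x]) [0..<T s]))"
    using assms(1) emits_bit[OF assms(2)] by (rule emits_concat_map) (simp only: assms(3))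
  moreover have "concat (map (\<lambda>x. [P s x]) xs) = map (P s) xs" for s xs
    by (induction xs) auto
  ultimately show ?thesis by simp
qed

lemma decides_const: "2 \<le> k \<Longrightarrow> decides k (\<lambda>s. b)"
proof (rule decidesI[where c = "put_bit k b" and p = "[:2:]"])
  fix s
  show "runs (put_bit k b) s (poly [:2:] (input_size k s)) (\<lambda>s'. preserves k s s' \<and> s' k = [b])"
    by (rule runs_put_bit) (auto simp: preserves_def)
qed (simp_all add: depends_below_def)

lemma emits_replicate:
  assumes "computes_nat k T"
  shows "emits k (\<lambda>s. replicate (T s) b)"
proof -
  have "2 \<le> k" using assms unfolding computes_nat_def by simp
  then have "emits k (\<lambda>s. map (\<lambda>x. b) [0..<T s])"
    using assms by (intro emits_map decides_const) auto
  then show ?thesis by (simp add: map_replicate_const)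
qed

text \<open>At level 2 the only register counted as input is register 0, so the time bound is a
  polynomial in the length of the word. A final copy moves the output into register 0.\<close>

lemma poly_time_computable_emits:
  assumes "emits 2 (\<lambda>s. F (s 0))"
  shows "poly_time_computable F"
  using assms
proof (rule emitsE)
  fix c p assume c: "\<And>s. runs c s (poly p (input_size 2 s)) (preserves 2 (s(1 := F (s 0) @ s 1)))"
  have "input_size 2 (init_state w) = length w" for w
    by (simp add: input_size_def init_state_def numeral_2_eq_2 lessThan_Suc insert_Diff_if)
  then have c': "runs c (init_state w) (poly p (length w)) (\<lambda>s'. s' 1 = F w)" for w
    using c[of "init_state w"] by (auto simp: preserves_def init_state_def elim: runs_mono)
  have "runs (Seq c (Copy 0 1)) (init_state w) (poly (p + [:1:]) (length w)) (\<lambda>s'. s' 0 = F w)" for w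
  proof (rule runs_Seq[where C = 1], rule runs_mono[OF c' order_refl])
    fix s' :: state assume "s' 1 = F w"
    then show "runs (Copy 0 1) s' 1 (\<lambda>s'. s' 0 = F w)" by (intro runs_Copy) auto
  qed simp
  then show ?thesis
    unfolding poly_time_computable_def runs_def by metis
qed

section \<open>Words as encodings of graphs\<close>

lemma length_encode_matrix: "length (encode_matrix n A) = n + 1 + n * n"
  by (simp add: encode_matrix_def length_concat comp_def sum_list_triv)

lemma nth_concat_rows:
  assumes "i < m" "j < n"
  shows "concat (map (\<lambda>i. map (A i) [0..<n]) [0..<m]) ! (i * n + j) = A i j"
  using assms(1)
proof (induction m)
  case (Suc m)
  let ?xs = "concat (map (\<lambda>i. map (A i) [0..<n]) [0..<m])"
  have len: "length ?xs = m * n" by (simp add: length_concat comp_def sum_list_triv)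
  show ?case
  proof (cases "i = m")
    case True
    have "(?xs @ map (A m) [0..<n]) ! (length ?xs + j) = A m j"
      using assms(2) by (simp only: nth_append_length_plus nth_map length_upt) simp
    with True len show ?thesis by simp
  next
    case False
    with Suc.prems have i: "i < m" by simp
    have "i * n + j < Suc i * n" using assms(2) by simp
    also have "\<dots> \<le> m * n" using i by (intro mult_right_mono) auto
    finally have "i * n + j < length ?xs" by (simp add: len)
    with Suc.IH[OF i] show ?thesis by (simp add: nth_append)
  qed
qed simp

lemma nth_encode_matrix:
  shows "i < n \<Longrightarrow> encode_matrix n A ! i"
    and "\<not> encode_matrix n A ! n"
    and "i < n \<Longrightarrow> j < n \<Longrightarrow> encode_matrix n A ! (n + 1 + (i * n + j)) = A i j"
proof -
  assume ij: "i < n" "j < n"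
  have "encode_matrix n A = (replicate n True @ [False]) @ concat (map (\<lambda>i. map (A i) [0..<n]) [0..<n])"
    by (simp add: encode_matrix_def)
  also have "\<dots> ! (length (replicate n True @ [False]) + (i * n + j)) = A i j"
    unfolding nth_append_length_plus by (rule nth_concat_rows[OF ij])
  finally show "encode_matrix n A ! (n + 1 + (i * n + j)) = A i j" by simp
qed (simp_all add: encode_matrix_def nth_append)

text \<open>The first \<open>False\<close> stands at position \<open>n\<close>, so \<open>n\<close>
  can be read off the word. It determines the length of the encoding and hence the split; entries
  are then compared position by position.\<close>

lemma encode_matrix_inj:
  assumes eq: "encode_matrix n A @ u = encode_matrix m B @ v"
  shows "n = m" "u = v" "\<And>i j. i < n \<Longrightarrow> j < n \<Longrightarrow> A i j \<longleftrightarrow> B i j"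
proof -
  have nth: "(encode_matrix n A @ u) ! i = encode_matrix n A ! i" if "i < n + 1 + n * n"
    for n A u i using that by (simp add: nth_append length_encode_matrix)
  have "\<not> n < m" if "encode_matrix n A @ u = encode_matrix m B @ v" for n m A B and u v :: "bool list"
  proof
    assume "n < m"
    then have "encode_matrix m B ! n" by (rule nth_encode_matrix)
    moreover have "(encode_matrix n A @ u) ! n = (encode_matrix m B @ v) ! n" by (simp only: that)
    ultimately show False
      using nth[of n n A u] nth[of n m B v] \<open>n < m\<close> nth_encode_matrix(2)[of n A] by simp
  qed
  from this[OF eq] this[OF eq[symmetric]] show "n = m" by simp
  then have len: "length (encode_matrix n A) = length (encode_matrix m B)"
    by (simp add: length_encode_matrix)
  with eq show "u = v" by simp
  fix i j assume ij: "i < n" "j < n"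
  have "encode_matrix n A = encode_matrix m B" using eq len by simp
  with nth_encode_matrix(3)[OF ij, of A] nth_encode_matrix(3)[of i m j B] ij \<open>n = m\<close>
  show "A i j \<longleftrightarrow> B i j" by simp
qed

text \<open>Membership provides some matrix with the same encoding; injectivity makes it agree with
  the given one on all indices below \<open>n\<close>.\<close>

lemma encode_matrix_in_SQUCO_RECOGNITION:
  assumes "simple_matrix n A"
  shows "encode_matrix n A \<in> SQUCO_RECOGNITION \<longleftrightarrow>
    matrix_iso n (matrix_square n A) (matrix_complement A)"
proof
  assume "encode_matrix n A \<in> SQUCO_RECOGNITION"
  then obtain m B where w: "encode_matrix n A @ [] = encode_matrix m B @ []"
    and iso: "matrix_iso m (matrix_square m B) (matrix_complement B)"
    unfolding mem_SQUCO_RECOGNITION append_Nil2 by blast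
  note inj = encode_matrix_inj[OF w]
  have "matrix_square n A u v \<longleftrightarrow> matrix_square n B u v"
    "matrix_complement A u v \<longleftrightarrow> matrix_complement B u v" if "u < n" "v < n" for u v
    using that inj(3) by (auto simp: matrix_square_def matrix_complement_def)
  from matrix_iso_cong[OF this] iso inj(1)
  show "matrix_iso n (matrix_square n A) (matrix_complement A)" by simp
qed (use assms mem_SQUCO_RECOGNITION in blast)

lemma encode_matrices_in_GRAPH_ISOMORPHISM:
  assumes "simple_matrix n A" "simple_matrix n B"
  shows "encode_matrix n A @ encode_matrix n B \<in> GRAPH_ISOMORPHISM \<longleftrightarrow> matrix_iso n A B"
proof
  assume "encode_matrix n A @ encode_matrix n B \<in> GRAPH_ISOMORPHISM"
  then obtain m A' B' where w: "encode_matrix n A @ encode_matrix n B = encode_matrix m A' @ encode_matrix m B'"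
    and iso: "matrix_iso m A' B'"
    unfolding mem_GRAPH_ISOMORPHISM by blast
  note inj = encode_matrix_inj[OF w]
  have "encode_matrix n B @ [] = encode_matrix m B' @ []" using inj(2) by simp
  note inj' = encode_matrix_inj[OF this]
  from matrix_iso_cong[OF inj(3) inj'(3)] iso inj(1) show "matrix_iso n A B" by simp
qed (use assms mem_GRAPH_ISOMORPHISM in blast)

text \<open>Every encoding contains the \<open>False\<close> that ends its prefix. The empty word
  can therefore serve as a negative instance of either problem.\<close>

lemma Nil_notin: "[] \<notin> SQUCO_RECOGNITION" "[] \<notin> GRAPH_ISOMORPHISM"
proof -
  have "[] \<noteq> encode_matrix n A" "[] \<noteq> encode_matrix n A @ w" for n A w
    by (simp_all add: encode_matrix_def)
  then show "[] \<notin> SQUCO_RECOGNITION" "[] \<notin> GRAPH_ISOMORPHISM"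
    unfolding mem_SQUCO_RECOGNITION mem_GRAPH_ISOMORPHISM by blast+
qed

section \<open>Recognizing encodings\<close>

text \<open>\<open>d\<close> is the position at which the encoding starts, which is nonzero for the
  second graph of a pair; the \<open>n + 1\<close> bits of the prefix are skipped.\<close>

definition block_matrix :: "bool list \<Rightarrow> nat \<Rightarrow> nat \<Rightarrow> nat \<Rightarrow> nat \<Rightarrow> bool" where
  "block_matrix w d n i j \<longleftrightarrow> bit_at w (d + (n + 1 + (i * n + j)))"

text \<open>The length is checked separately, in \<open>valid_graph\<close> and
  \<open>valid_pair\<close>.\<close>

definition valid_block :: "bool list \<Rightarrow> nat \<Rightarrow> nat \<Rightarrow> bool" where
  "valid_block w d n \<longleftrightarrow> (\<forall>i<n. bit_at w (d + i)) \<and> \<not> bit_at w (d + n) \<and>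
    simple_matrix n (block_matrix w d n)"

lemma encode_matrix_block:
  assumes "valid_block w d n" "d + (n + 1 + n * n) \<le> length w"
  shows "take (n + 1 + n * n) (drop d w) = encode_matrix n (block_matrix w d n)"
proof (rule nth_equalityI)
  show "length (take (n + 1 + n * n) (drop d w)) = length (encode_matrix n (block_matrix w d n))"
    using assms(2) by (simp add: length_encode_matrix)
  fix q assume "q < length (take (n + 1 + n * n) (drop d w))"
  then have q: "q < n + 1 + n * n" by simp
  then have lhs: "take (n + 1 + n * n) (drop d w) ! q \<longleftrightarrow> bit_at w (d + q)"
    using assms(2) by (simp add: bit_at_def)
  consider "q < n" | "q = n" | "n + 1 \<le> q" by linarith
  then show "take (n + 1 + n * n) (drop d w) ! q = encode_matrix n (block_matrix w d n) ! q"
  proof cases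
    case 1
    with assms(1) lhs nth_encode_matrix(1)[OF 1] show ?thesis by (simp add: valid_block_def)
  next
    case 2
    with assms(1) lhs nth_encode_matrix(2) show ?thesis by (simp add: valid_block_def)
  next
    case 3
    with q have "q - (n + 1) < n * n" by linarith
    then obtain i j where ij: "i < n" "j < n" "q - (n + 1) = i * n + j" by (rule pair_codeE)
    with 3 have "q = n + 1 + (i * n + j)" by linarith
    with lhs nth_encode_matrix(3)[OF ij(1,2), of "block_matrix w d n"] show ?thesis
      unfolding block_matrix_def by simp
  qed
qed

lemma simple_matrix_cong:
  assumes "\<And>i j. i < n \<Longrightarrow> j < n \<Longrightarrow> A i j \<longleftrightarrow> B i j"
  shows "simple_matrix n A \<longleftrightarrow> simple_matrix n B"
  using assms unfolding simple_matrix_def by metis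

lemma valid_block_encode:
  assumes "simple_matrix n A"
  shows "valid_block (u @ encode_matrix n A @ v) (length u) n"
proof -
  let ?w = "u @ encode_matrix n A @ v"
  have bit: "bit_at ?w (length u + q) \<longleftrightarrow> encode_matrix n A ! q" if "q < n + 1 + n * n" for q
    using that by (simp add: bit_at_def length_encode_matrix nth_append)
  have "block_matrix ?w (length u) n i j \<longleftrightarrow> A i j" if "i < n" "j < n" for i j
    using bit[of "n + 1 + (i * n + j)"] nth_encode_matrix(3)[OF that, of A] pair_code_less[OF that]
    unfolding block_matrix_def by simp
  then have "simple_matrix n (block_matrix ?w (length u) n)"
    using assms simple_matrix_cong by blast
  moreover have "bit_at ?w (length u + i)" if "i < n" for i
    using bit[of i] nth_encode_matrix(1)[OF that] that by simp
  moreover have "\<not> bit_at ?w (length u + n)"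
    using bit[of n] nth_encode_matrix(2) by simp
  ultimately show ?thesis unfolding valid_block_def by blast
qed

definition valid_graph :: "bool list \<Rightarrow> nat \<Rightarrow> bool" where
  "valid_graph w n \<longleftrightarrow> length w = n + 1 + n * n \<and> valid_block w 0 n"

text \<open>A single \<open>n\<close> suffices for both blocks, since graphs with different numbers
  of vertices are never isomorphic.\<close>

definition valid_pair :: "bool list \<Rightarrow> nat \<Rightarrow> bool" where
  "valid_pair w n \<longleftrightarrow> length w = (n + 1 + n * n) + (n + 1 + n * n) \<and>
    valid_block w 0 n \<and> valid_block w (n + 1 + n * n) n"

lemma valid_graphD:
  assumes "valid_graph w n"
  shows "simple_matrix n (block_matrix w 0 n)" "w = encode_matrix n (block_matrix w 0 n)"
  using assms encode_matrix_block[of w 0 n] unfolding valid_graph_def valid_block_def by auto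

lemma valid_pairD:
  assumes "valid_pair w n"
  shows "simple_matrix n (block_matrix w 0 n)" "simple_matrix n (block_matrix w (n + 1 + n * n) n)"
    "w = encode_matrix n (block_matrix w 0 n) @ encode_matrix n (block_matrix w (n + 1 + n * n) n)"
proof -
  let ?l = "n + 1 + n * n"
  have l: "length w = ?l + ?l" and v: "valid_block w 0 n" "valid_block w ?l n"
    using assms unfolding valid_pair_def by blast+
  then show "simple_matrix n (block_matrix w 0 n)" "simple_matrix n (block_matrix w ?l n)"
    unfolding valid_block_def by blast+
  have "take ?l (drop 0 w) = encode_matrix n (block_matrix w 0 n)"
    using l by (intro encode_matrix_block[OF v(1)]) simp
  moreover have "take ?l (drop ?l w) = encode_matrix n (block_matrix w ?l n)"
    using l by (intro encode_matrix_block[OF v(2)]) simp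
  moreover have "take ?l (drop ?l w) = drop ?l w" using l by simp
  ultimately show "w = encode_matrix n (block_matrix w 0 n) @ encode_matrix n (block_matrix w ?l n)"
    by (metis append_take_drop_id drop_0)
qed

lemma valid_graph_encode: "simple_matrix n A \<Longrightarrow> valid_graph (encode_matrix n A) n"
  using valid_block_encode[of n A "[]" "[]"] by (simp add: valid_graph_def length_encode_matrix)

lemma valid_pair_encode:
  "simple_matrix n A \<Longrightarrow> simple_matrix n B \<Longrightarrow> valid_pair (encode_matrix n A @ encode_matrix n B) n"
  using valid_block_encode[of n A "[]" "encode_matrix n B"]
    valid_block_encode[of n B "encode_matrix n A" "[]"]
  by (simp add: valid_pair_def length_encode_matrix)

lemma valid_graph_unique: "valid_graph w n \<Longrightarrow> valid_graph w m \<Longrightarrow> n = m"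
  using valid_graphD(2) encode_matrix_inj(1)[of n _ "[]" m _ "[]"] by (metis append_Nil2)

lemma valid_pair_unique: "valid_pair w n \<Longrightarrow> valid_pair w m \<Longrightarrow> n = m"
  using valid_pairD(3) encode_matrix_inj(1)[of n _ _ m] by metis

text \<open>This replaces a search for \<open>n\<close>: all candidates are tried, the wrong ones
  emit nothing, and the right one is unique. Output of this form can be produced by a bounded
  loop.\<close>

lemma concat_map_guarded:
  assumes "n < L" "P n" "\<And>m. P m \<Longrightarrow> m = n"
  shows "concat (map (\<lambda>m. if P m then g m else []) [0..<L]) = g n"
proof -
  have empty: "concat (map (\<lambda>m. if P m then g m else []) xs) = []" if "n \<notin> set xs" for xs
    using that assms(3) by (induction xs) auto
  have "[0..<L] = [0..<n] @ n # [Suc n..<L]"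
    using assms(1) upt_add_eq_append[of 0 n "L - n"] by (simp add: upt_conv_Cons)
  then show ?thesis using assms(2) by (simp add: empty)
qed

section \<open>The two reductions\<close>

definition squco_to_gi :: "bool list \<Rightarrow> bool list" where
  "squco_to_gi w = concat (map (\<lambda>n. if valid_graph w n
    then encode_matrix n (matrix_square n (block_matrix w 0 n)) @
      encode_matrix n (matrix_complement (block_matrix w 0 n))
    else []) [0..<length w])"

text \<open>\<open>[False]\<close> encodes the graph without vertices, a positive instance, and
  \<open>[]\<close> is a negative one; they answer the small cases directly. Malformed words also
  yield \<open>[]\<close>. The range of \<open>n\<close> is large enough because an encoding is
  longer than its prefix.\<close>

definition gi_to_squco :: "bool list \<Rightarrow> bool list" where
  "gi_to_squco w = concat (map (\<lambda>n. if valid_pair w n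
    then if n \<le> 2 then if \<forall>i<n. \<forall>j<n. block_matrix w 0 n i j \<longleftrightarrow> block_matrix w (n + 1 + n * n) n i j
        then [False] else []
      else encode_matrix (gadget_size n)
        (gadget_graph n (block_matrix w 0 n) (block_matrix w (n + 1 + n * n) n))
    else []) [0..<length w])"

section \<open>Correctness of the reductions\<close>

lemma simple_matrix_square:
  assumes "simple_matrix n A"
  shows "simple_matrix n (matrix_square n A)"
  using assms unfolding simple_matrix_def matrix_square_def by blast

lemma simple_matrix_complement:
  assumes "simple_matrix n A"
  shows "simple_matrix n (matrix_complement A)"
  using assms unfolding simple_matrix_def matrix_complement_def by blast

lemma squco_to_gi_correct: "w \<in> SQUCO_RECOGNITION \<longleftrightarrow> squco_to_gi w \<in> GRAPH_ISOMORPHISM"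
proof (cases "\<exists>n. valid_graph w n")
  case True
  then obtain n where n: "valid_graph w n" by blast
  let ?A = "block_matrix w 0 n"
  note A = valid_graphD[OF n]
  have "n < length w" using n by (simp add: valid_graph_def)
  then have red: "squco_to_gi w =
      encode_matrix n (matrix_square n ?A) @ encode_matrix n (matrix_complement ?A)"
    unfolding squco_to_gi_def using n valid_graph_unique by (intro concat_map_guarded) blast+
  have "w \<in> SQUCO_RECOGNITION \<longleftrightarrow> matrix_iso n (matrix_square n ?A) (matrix_complement ?A)"
    using encode_matrix_in_SQUCO_RECOGNITION[OF A(1)] A(2) by metis
  then show ?thesis
    unfolding red by (simp only: encode_matrices_in_GRAPH_ISOMORPHISM[OF
      simple_matrix_square[OF A(1)] simple_matrix_complement[OF A(1)]])
next
  case False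
  then have "w \<notin> SQUCO_RECOGNITION"
    using valid_graph_encode unfolding mem_SQUCO_RECOGNITION by blast
  moreover have "squco_to_gi w = []" using False by (simp add: squco_to_gi_def)
  ultimately show ?thesis using Nil_notin by simp
qed

text \<open>On at most two vertices a bijection maps a pair of distinct vertices to itself up to
  order, and the matrices are symmetric.\<close>

lemma matrix_iso_small:
  assumes n: "n \<le> 2" and A: "simple_matrix n A" and B: "simple_matrix n B"
  shows "matrix_iso n A B \<longleftrightarrow> (\<forall>i<n. \<forall>j<n. A i j \<longleftrightarrow> B i j)"
proof
  assume "matrix_iso n A B"
  then obtain f where f: "bij_betw f {..<n} {..<n}"
    and iso: "\<And>i j. i < n \<Longrightarrow> j < n \<Longrightarrow> A i j \<longleftrightarrow> B (f i) (f j)"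
    unfolding matrix_iso_def by blast
  have f': "f i < n" if "i < n" for i using bij_betw_apply[OF f] that by blast
  have "A i j \<longleftrightarrow> B i j" if ij: "i < n" "j < n" for i j
  proof (cases "i = j")
    case True
    then show ?thesis using A B ij unfolding simple_matrix_def by blast
  next
    case False
    then have "f i \<noteq> f j" using f ij by (auto dest: bij_betw_imp_inj_on inj_onD)
    then have "f i = i \<and> f j = j \<or> f i = j \<and> f j = i"
      using False ij f'[OF ij(1)] f'[OF ij(2)] n by linarith
    then show ?thesis using iso[OF ij] B ij unfolding simple_matrix_def by metis
  qed
  then show "\<forall>i<n. \<forall>j<n. A i j \<longleftrightarrow> B i j" by blast
next
  assume "\<forall>i<n. \<forall>j<n. A i j \<longleftrightarrow> B i j"
  then show "matrix_iso n A B"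
    unfolding matrix_iso_def by (intro exI[of _ id]) auto
qed

lemma False_in_SQUCO_RECOGNITION: "[False] \<in> SQUCO_RECOGNITION"
proof -
  have "encode_matrix 0 (\<lambda>i j. False) \<in> SQUCO_RECOGNITION"
    by (subst encode_matrix_in_SQUCO_RECOGNITION) (auto simp: simple_matrix_def matrix_iso_def)
  then show ?thesis by (simp add: encode_matrix_def)
qed

lemma gi_to_squco_correct: "w \<in> GRAPH_ISOMORPHISM \<longleftrightarrow> gi_to_squco w \<in> SQUCO_RECOGNITION"
proof (cases "\<exists>n. valid_pair w n")
  case True
  then obtain n where n: "valid_pair w n" by blast
  let ?A = "block_matrix w 0 n" and ?B = "block_matrix w (n + 1 + n * n) n"
  note AB = valid_pairD[OF n]
  have "n < length w" using n by (simp add: valid_pair_def)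
  then have red: "gi_to_squco w = (if n \<le> 2 then if \<forall>i<n. \<forall>j<n. ?A i j \<longleftrightarrow> ?B i j then [False] else []
      else encode_matrix (gadget_size n) (gadget_graph n ?A ?B))"
    unfolding gi_to_squco_def using n valid_pair_unique by (intro concat_map_guarded) blast+
  have w: "w \<in> GRAPH_ISOMORPHISM \<longleftrightarrow> matrix_iso n ?A ?B"
    using encode_matrices_in_GRAPH_ISOMORPHISM[OF AB(1,2)] AB(3) by metis
  show ?thesis
  proof (cases "n \<le> 2")
    case True
    then show ?thesis
      using matrix_iso_small[OF True AB(1,2)] w False_in_SQUCO_RECOGNITION Nil_notin(1)
      unfolding red by (simp only: if_True split: if_split) blast
  next
    case False
    then have "3 \<le> n" by simp
    from squco_gadget_iff[OF this AB(1,2)] w show ?thesis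
      unfolding red if_not_P[OF False]
      by (simp only: encode_matrix_in_SQUCO_RECOGNITION[OF simple_matrix_bipartite])
  qed
next
  case False
  then have "w \<notin> GRAPH_ISOMORPHISM"
    using valid_pair_encode unfolding mem_GRAPH_ISOMORPHISM by blast
  moreover have "gi_to_squco w = []" using False by (simp add: gi_to_squco_def)
  ultimately show ?thesis using Nil_notin by simp
qed

text \<open>These closure rules act as a compiler: once definitions are unfolded, the outermost
  operation of a term or formula selects the rule, and each bound variable raises the level by
  one.\<close>

lemmas computable_intros =
  emits_concat_map emits_map emits_replicate emits_append emits_if emits_bit emits_Nil
  decides_const decides_not decides_conj decides_disj decides_imp decides_iff decides_if decides_ex decides_all decides_less decides_le decides_eq
  decides_bit_at computes_nat_const computes_nat_var computes_nat_add computes_nat_diff computes_nat_mult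

lemmas computable_defs =
  encode_matrix_def valid_graph_def valid_pair_def valid_block_def simple_matrix_def
  block_matrix_def matrix_square_def matrix_complement_def bipartite_def gadget_def incidence_def

text \<open>The goals left by the rules say that register numbers are in range and that a term is
  unaffected by an update of a register it does not mention.\<close>

lemmas computable_side_conds =
  fun_upd_apply nat.inject nat.distinct if_False less_Suc_eq One_nat_def le_refl Suc_le_mono zero_le
  simp_thms numeral_2_eq_2

lemma poly_time_squco_to_gi: "poly_time_computable squco_to_gi"
proof (rule poly_time_computable_emits)
  show "emits 2 (\<lambda>s. squco_to_gi (s 0))"
    unfolding squco_to_gi_def computable_defs numeral_2_eq_2
    by (intro computable_intros; simp only: computable_side_conds; fail)
qed

lemma poly_time_gi_to_squco: "poly_time_computable gi_to_squco"
proof (rule poly_time_computable_emits)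
  show "emits 2 (\<lambda>s. gi_to_squco (s 0))"
    unfolding gi_to_squco_def computable_defs numeral_2_eq_2
    by (intro computable_intros; simp only: computable_side_conds; fail)
qed

theorem theorem4p2:
  shows "graph_isomorphism_complete SQUCO_RECOGNITION"
  unfolding graph_isomorphism_complete_def poly_equivalent_def poly_reducible_def
  using poly_time_squco_to_gi squco_to_gi_correct poly_time_gi_to_squco gi_to_squco_correct
  by blast

end
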